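(* Let $d\ge 3$. (a) Two $d$-dimensional polytopes $P,Q\subset\mathbb{R}^d$ are pointwise affine-slice-equivalent if and only if $P=Q$. (b) For every $d\ge 3$, combinatorially equivalent polytopes need not be setwise affine-slice-equivalent: there exist $d$-dimensional polytopes $P,Q\subset\mathbb{R}^d$ that are combinatorially equivalent but not setwise affine-slice-equivalent. (c) Conversely, for $d=3$, setwise affine-slice-equivalent polytopes can be combinatorially distinct and can even have different $f$-vectors: there exist $3$-dimensional polytopes $P,Q\subset\mathbb{R}^3$ that are setwise affine-slice-equivalent but have different $f$-vectors (in particular, they are not combinatorially equivalent).
   Context: Polytopes are combinatorially equivalent ($\simeq$) if their face lattices are isomorphic. An affine slice of $P\subset\mathbb{R}^d$ is an intersection $P\cap H$ with an affine hyperplane $H$ (possibly empty). $P,Q\subset\mathbb{R}^d$ are pointwise affine-slice-equivalent if $P\cap H\simeq Q\cap H$ for every affine hyperplane $H\subset\mathbb{R}^d$; they are setwise affine-slice-equivalent if the set of combinatorial types of affine slices of $P$ agrees with that of $Q$. The $f$-vector records the numbers $f_k$ of $k$-dimensional faces. *)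

theory Defs
  imports "HOL-Analysis.Analysis"
begin

definition faces :: "'a::euclidean_space set \<Rightarrow> 'a set set" where
  "faces P = {F. F face_of P}"

text \<open>The face lattice is ordered by inclusion and contains the improper faces: both the empty
  set and (for convex \<open>P\<close>) \<open>P\<close> itself satisfy the library predicate \<^const>\<open>face_of\<close>.  In
  particular, the empty polytope has a one-element face lattice and is not equivalent to a point.
  An order isomorphism of lattices is automatically a lattice isomorphism.\<close>

definition comb_equiv :: "'a::euclidean_space set \<Rightarrow> 'b::euclidean_space set \<Rightarrow> bool"
    (infix "\<simeq>\<^sub>c" 50) where
  "P \<simeq>\<^sub>c Q \<longleftrightarrow>
    (\<exists>\<phi>. bij_betw \<phi> (faces P) (faces Q) \<and>
         (\<forall>F\<in>faces P. \<forall>G\<in>faces P. F \<subseteq> G \<longleftrightarrow> \<phi> F \<subseteq> \<phi> G))"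

text \<open>A combinatorial type is an equivalence class of polytopes, represented here by its members
  in the same ambient space.\<close>

definition comb_type :: "'a::euclidean_space set \<Rightarrow> 'a set set" where
  "comb_type P = {R. polytope R \<and> R \<simeq>\<^sub>c P}"

definition affine_hyperplanes :: "'a::euclidean_space set set" where
  "affine_hyperplanes = {H. \<exists>a b. a \<noteq> 0 \<and> H = {x. a \<bullet> x = b}}"

definition pointwise_slice_equiv :: "'a::euclidean_space set \<Rightarrow> 'a set \<Rightarrow> bool" where
  "pointwise_slice_equiv P Q \<longleftrightarrow> (\<forall>H\<in>affine_hyperplanes. P \<inter> H \<simeq>\<^sub>c Q \<inter> H)"

definition setwise_slice_equiv :: "'a::euclidean_space set \<Rightarrow> 'a set \<Rightarrow> bool" where
  "setwise_slice_equiv P Q \<longleftrightarrow>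
    {comb_type (P \<inter> H) |H. H \<in> affine_hyperplanes} =
    {comb_type (Q \<inter> H) |H. H \<in> affine_hyperplanes}"

text \<open>The \<open>f\<close>-vector is indexed by all \<open>k \<ge> 0\<close>; for a \<open>d\<close>-dimensional polytope the entry at
  \<open>k = d\<close> is 1 and the entries beyond are 0.\<close>

definition f_vector :: "'a::euclidean_space set \<Rightarrow> nat \<Rightarrow> nat" where
  "f_vector P k = card {F \<in> faces P. aff_dim F = int k}"

definition full_dim_polytope :: "'a::euclidean_space set \<Rightarrow> bool" where
  "full_dim_polytope P \<longleftrightarrow> polytope P \<and> aff_dim P = int DIM('a)"

end

theory Submission
  imports Defs
begin

text \<open>(a) A hyperplane misses \<open>P\<close> iff it misses \<open>Q\<close>, since the empty slice is recognised by its face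
  lattice; strict separation of a point from a polytope then gives \<open>P = Q\<close>.

  (b) Slices are told apart by the number of coatoms of their face lattice.  No hyperplane crosses all
  \<open>2\<^sup>d\<close> facets of the regular crosspolytope: for \<open>\<alpha> \<bullet> x = \<gamma>\<close> with \<open>\<gamma> \<ge> 0\<close>, the facet whose signs are
  opposite to those of \<open>\<alpha>\<close> obstructs it.  After shifting one pair of antipodal vertices parallel to
  another axis, some hyperplane does.  The shift extends to a homeomorphism, linear on two
  half-spaces, that preserves which facet inequalities are tight, so the face lattice is unchanged.

  (c) The square pyramid and the triangular prism both have five facets, so their slices are empty,
  points, segments or \<open>n\<close>-gons with \<open>n \<le> 5\<close>, and all of these occur for both; but they have five and
  six vertices.  An \<open>n\<close>-gon is determined by \<open>n\<close> because its edges form a 2-regular graph on at most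
  five vertices, which must be a single cycle.\<close>

section \<open>Combinatorial equivalence and coatoms\<close>

definition coatoms :: "'a::euclidean_space set \<Rightarrow> 'a set set" where
  "coatoms P = {F \<in> faces P. F \<noteq> P \<and> (\<forall>G\<in>faces P. F \<subseteq> G \<longrightarrow> G = F \<or> G = P)}"

lemma comb_equivE:
  assumes "P \<simeq>\<^sub>c Q"
  obtains \<phi> where "bij_betw \<phi> (faces P) (faces Q)"
    "\<And>F G. F \<in> faces P \<Longrightarrow> G \<in> faces P \<Longrightarrow> F \<subseteq> G \<longleftrightarrow> \<phi> F \<subseteq> \<phi> G"
  using assms unfolding comb_equiv_def by (elim exE conjE) simp

lemma comb_equiv_refl: "P \<simeq>\<^sub>c P"
  unfolding comb_equiv_def by (intro exI[of _ id]) auto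

lemma comb_equiv_sym:
  assumes "P \<simeq>\<^sub>c Q" shows "Q \<simeq>\<^sub>c P"
proof -
  obtain \<phi> where b: "bij_betw \<phi> (faces P) (faces Q)"
    and o: "\<And>F G. F \<in> faces P \<Longrightarrow> G \<in> faces P \<Longrightarrow> F \<subseteq> G \<longleftrightarrow> \<phi> F \<subseteq> \<phi> G"
    using assms(1) comb_equivE by metis
  let ?\<psi> = "inv_into (faces P) \<phi>"
  have "?\<psi> F \<in> faces P" "\<phi> (?\<psi> F) = F" if "F \<in> faces Q" for F
    using b that by (auto simp: bij_betw_def inv_into_into f_inv_into_f)
  then show ?thesis
    unfolding comb_equiv_def using bij_betw_inv_into[OF b] o by metis
qed

lemma comb_equiv_trans:
  assumes "P \<simeq>\<^sub>c Q" "Q \<simeq>\<^sub>c R" shows "P \<simeq>\<^sub>c R"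
proof -
  obtain \<phi> where b1: "bij_betw \<phi> (faces P) (faces Q)"
    and o1: "\<And>F G. F \<in> faces P \<Longrightarrow> G \<in> faces P \<Longrightarrow> F \<subseteq> G \<longleftrightarrow> \<phi> F \<subseteq> \<phi> G"
    using assms(1) comb_equivE by metis
  obtain \<psi> where b2: "bij_betw \<psi> (faces Q) (faces R)"
    and o2: "\<And>F G. F \<in> faces Q \<Longrightarrow> G \<in> faces Q \<Longrightarrow> F \<subseteq> G \<longleftrightarrow> \<psi> F \<subseteq> \<psi> G"
    using assms(2) comb_equivE by metis
  have "\<phi> F \<in> faces Q" if "F \<in> faces P" for F
    using b1 that by (auto simp: bij_betw_def)
  with o1 o2 show ?thesis
    unfolding comb_equiv_def using bij_betw_trans[OF b1 b2] by (intro exI[of _ "\<psi> \<circ> \<phi>"]) auto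
qed

lemma comb_type_eq_iff:
  assumes "polytope P"
  shows "comb_type P = comb_type Q \<longleftrightarrow> P \<simeq>\<^sub>c Q"
  using assms comb_equiv_refl comb_equiv_sym comb_equiv_trans unfolding comb_type_def by blast

text \<open>An order isomorphism matches greatest elements, hence the maximal elements below them;
  convexity makes \<open>P\<close> and \<open>Q\<close> the greatest faces.\<close>

lemma card_coatoms_comb_equiv:
  assumes "P \<simeq>\<^sub>c Q" "convex P" "convex Q"
  shows "card (coatoms P) = card (coatoms Q)"
proof -
  obtain \<phi> where b: "bij_betw \<phi> (faces P) (faces Q)"
    and o: "\<And>F G. F \<in> faces P \<Longrightarrow> G \<in> faces P \<Longrightarrow> F \<subseteq> G \<longleftrightarrow> \<phi> F \<subseteq> \<phi> G"
    using assms(1) comb_equivE by metis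
  have PP: "P \<in> faces P" and QQ: "Q \<in> faces Q"
    using assms by (auto simp: faces_def face_of_refl)
  have top: "\<phi> P = Q"
  proof -
    obtain F where "F \<in> faces P" "\<phi> F = Q"
      using b QQ by (metis bij_betw_def imageE)
    then have "Q \<subseteq> \<phi> P"
      using o[of F P] PP by (auto simp: faces_def dest: face_of_imp_subset)
    moreover have "\<phi> P \<in> faces Q" using b PP by (auto simp: bij_betw_def)
    ultimately show ?thesis by (auto simp: faces_def dest: face_of_imp_subset)
  qed
  have inj: "\<phi> F = \<phi> G \<longleftrightarrow> F = G" if "F \<in> faces P" "G \<in> faces P" for F G
    using b that by (auto simp: bij_betw_def inj_on_def)
  have im: "faces Q = \<phi> ` faces P" using b by (simp add: bij_betw_def)
  have eqQ: "\<phi> F = Q \<longleftrightarrow> F = P" if "F \<in> faces P" for F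
    using inj[OF that PP] top by simp
  have "\<phi> F \<in> coatoms Q \<longleftrightarrow> F \<in> coatoms P" if F: "F \<in> faces P" for F
    by (simp add: coatoms_def im eqQ F inj o[OF F, symmetric] cong: ball_cong)
  moreover have "coatoms Q \<subseteq> \<phi> ` faces P" "coatoms P \<subseteq> faces P"
    by (auto simp: coatoms_def im)
  ultimately have "coatoms Q = \<phi> ` coatoms P" by blast
  moreover have "inj_on \<phi> (coatoms P)"
    using inj by (auto simp: inj_on_def coatoms_def)
  ultimately show ?thesis by (simp add: card_image)
qed

section \<open>Faces of polyhedra given by inequalities\<close>

text \<open>The affine set \<open>A\<close> is a parameter so that a slice by a hyperplane keeps the
  same inequalities; the index set labels them so that facets of different polyhedra can be
  matched.\<close>

definition hpoly :: "'a::euclidean_space set \<Rightarrow> 'i set \<Rightarrow> ('i \<Rightarrow> 'a) \<Rightarrow> ('i \<Rightarrow> real) \<Rightarrow> 'a set" where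
  "hpoly A I a b = {x \<in> A. \<forall>i\<in>I. a i \<bullet> x \<le> b i}"

lemma hpoly_eq_Int: "hpoly A I a b = A \<inter> (\<Inter>i\<in>I. {x. a i \<bullet> x \<le> b i})"
  by (auto simp: hpoly_def)

lemma polyhedron_hpoly:
  assumes "affine A" "finite I"
  shows "polyhedron (hpoly A I a b)"
  unfolding hpoly_eq_Int using assms affine_imp_polyhedron
  by (intro polyhedron_Int polyhedron_Inter) (auto intro: polyhedron_halfspace_le)

text \<open>Each tight inequality cuts out a face by a supporting hyperplane, and faces are closed
  under intersection.\<close>

lemma tight_face_of_hpoly:
  assumes "affine A" "finite I" "J \<subseteq> I"
  shows "{x \<in> hpoly A I a b. \<forall>i\<in>J. a i \<bullet> x = b i} face_of hpoly A I a b"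
\<comment> \<open>An intersection over no index would be \<open>UNIV\<close> instead of the
  polyhedron.\<close>
proof (cases "J = {}")
  case True
  then show ?thesis
    using polyhedron_imp_convex[OF polyhedron_hpoly[OF assms(1,2)]] by (simp add: face_of_refl)
next
  case False
  have "(\<Inter>i\<in>J. hpoly A I a b \<inter> {x. a i \<bullet> x = b i}) face_of hpoly A I a b"
    using assms False polyhedron_imp_convex[OF polyhedron_hpoly[OF assms(1,2)]]
    by (intro face_of_Inter) (auto intro!: face_of_Int_supporting_hyperplane_le simp: hpoly_def)
  moreover have "(\<Inter>i\<in>J. hpoly A I a b \<inter> {x. a i \<bullet> x = b i})
      = {x \<in> hpoly A I a b. \<forall>i\<in>J. a i \<bullet> x = b i}"
    using False by auto
  ultimately show ?thesis by simp
qed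

text \<open>A relative interior point \<open>x\<close> of \<open>F\<close> is tight only where all
  of \<open>F\<close> is. From any \<open>y\<close> that is tight on \<open>J\<close> one can
  therefore step slightly past \<open>x\<close> without leaving the polyhedron; \<open>x\<close> is
  then inside a segment starting at \<open>y\<close>, and the face property puts \<open>y\<close>
  into \<open>F\<close>.\<close>

lemma face_of_hpoly_eq_tight:
  assumes A: "affine A" and I: "finite I" and F: "F face_of hpoly A I a b" "F \<noteq> {}"
    and J: "J = {i\<in>I. \<forall>x\<in>F. a i \<bullet> x = b i}"
  shows "F = {x \<in> hpoly A I a b. \<forall>i\<in>J. a i \<bullet> x = b i}"
proof
  show "F \<subseteq> {x \<in> hpoly A I a b. \<forall>i\<in>J. a i \<bullet> x = b i}"
    using face_of_imp_subset[OF F(1)] J by auto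
  have FS: "F \<subseteq> hpoly A I a b" using face_of_imp_subset[OF F(1)] .
  have "convex F" using F face_of_imp_convex by blast
  then obtain x where x: "x \<in> rel_interior F"
    using F rel_interior_eq_empty by blast
  then have xF: "x \<in> F" using rel_interior_subset by blast
  \<comment> \<open>The face cut out by an inequality tight at \<open>x\<close> meets the relative
    interior of \<open>F\<close>, hence contains \<open>F\<close>.\<close>
  have strict: "a i \<bullet> x < b i" if i: "i \<in> I" "i \<notin> J" for i
  proof (rule ccontr)
    assume "\<not> ?thesis"
    moreover have "a i \<bullet> x \<le> b i" using xF FS i by (auto simp: hpoly_def)
    ultimately have eq: "a i \<bullet> x = b i" by simp
    have "{y \<in> hpoly A I a b. \<forall>j\<in>{i}. a j \<bullet> y = b j} face_of hpoly A I a b"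
      using i by (intro tight_face_of_hpoly A I) auto
    then have "F \<subseteq> {y \<in> hpoly A I a b. \<forall>j\<in>{i}. a j \<bullet> y = b j}"
      by (rule subset_of_face_of[OF _ FS]) (use x xF FS eq in auto)
    then show False using i J by auto
  qed
  show "{x \<in> hpoly A I a b. \<forall>i\<in>J. a i \<bullet> x = b i} \<subseteq> F"
  proof
    fix y assume y: "y \<in> {x \<in> hpoly A I a b. \<forall>i\<in>J. a i \<bullet> x = b i}"
    \<comment> \<open>Finitely many strict inequalities at \<open>x\<close> survive a common small
      step.\<close>
    have "\<forall>i\<in>I-J. eventually (\<lambda>e. a i \<bullet> (x + e *\<^sub>R (x - y)) < b i) (at_right (0::real))"
    proof
      fix i assume i: "i \<in> I - J"
      have "((\<lambda>e. a i \<bullet> (x + e *\<^sub>R (x - y))) \<longlongrightarrow> a i \<bullet> (x + 0 *\<^sub>R (x - y))) (at_right (0::real))"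
        by (intro tendsto_intros)
      then show "eventually (\<lambda>e. a i \<bullet> (x + e *\<^sub>R (x - y)) < b i) (at_right (0::real))"
        using strict i by (intro order_tendstoD(2)) auto
    qed
    then have "eventually (\<lambda>e. \<forall>i\<in>I-J. a i \<bullet> (x + e *\<^sub>R (x - y)) < b i) (at_right (0::real))"
      using I by (simp add: eventually_ball_finite)
    moreover have "eventually (\<lambda>e. e > 0) (at_right (0::real))"
      by (simp add: eventually_at_right_less)
    ultimately have "eventually (\<lambda>e. e > 0 \<and> (\<forall>i\<in>I-J. a i \<bullet> (x + e *\<^sub>R (x - y)) < b i)) (at_right (0::real))"
      by eventually_elim auto
    then obtain e where e: "e > 0" "\<And>i. i \<in> I - J \<Longrightarrow> a i \<bullet> (x + e *\<^sub>R (x - y)) < b i"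
      using eventually_happens'[of "at_right (0::real)"] by force
    let ?z = "x + e *\<^sub>R (x - y)"
    have zA: "?z \<in> A"
    proof -
      have "x \<in> A" "y \<in> A" using xF FS y by (auto simp: hpoly_def)
      then have "(1 + e) *\<^sub>R x + (- e) *\<^sub>R y \<in> A" using A by (intro mem_affine) auto
      moreover have "(1 + e) *\<^sub>R x + (- e) *\<^sub>R y = ?z" by (simp add: algebra_simps)
      ultimately show ?thesis by simp
    qed
    have "a i \<bullet> ?z = b i" if "i \<in> J" for i
      using that y xF J by (auto simp: inner_add_right inner_diff_right)
    then have "a i \<bullet> ?z \<le> b i" if "i \<in> I" for i
      using that e(2)[of i] by (cases "i \<in> J") (auto simp: less_imp_le)
    with zA have zS: "?z \<in> hpoly A I a b" by (auto simp: hpoly_def)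
    show "y \<in> F"
    proof (cases "y = x")
      case False
      have "(1 + e) *\<^sub>R x = e *\<^sub>R y + ?z" by (simp add: algebra_simps)
      then have "x = (1/(1+e)) *\<^sub>R (e *\<^sub>R y + ?z)"
        using e(1) by (metis divide_self_if scaleR_one scaleR_scaleR times_divide_eq_left mult_1
            add_pos_pos zero_less_one less_irrefl)
      moreover have "e / (1+e) = 1 - 1/(1+e)" using e(1) by (simp add: field_simps)
      ultimately have "x = (1 - 1/(1+e)) *\<^sub>R y + (1/(1+e)) *\<^sub>R ?z"
        by (metis scaleR_add_right scaleR_scaleR times_divide_eq_left mult_1)
      moreover have "y \<noteq> ?z"
      proof
        assume "y = ?z"
        then have "(1 + e) *\<^sub>R (x - y) = 0" by (simp add: algebra_simps)
        then show False using e False by auto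
      qed
      ultimately have "x \<in> open_segment y ?z"
        using e by (auto simp: in_segment intro!: exI[of _ "1/(1+e)"])
      then show ?thesis using face_ofD[OF F(1)] y zS xF by blast
    qed (use xF in auto)
  qed
qed

text \<open>A proper nonempty face has a tight inequality that is not tight on the whole polyhedron;
  alone it cuts out a proper face containing \<open>F\<close>, and maximality gives
  equality.\<close>

lemma nonempty_coatom_of_hpoly:
  assumes A: "affine A" and I: "finite I" and F: "F \<in> coatoms (hpoly A I a b)" "F \<noteq> {}"
  shows "\<exists>i\<in>I. F = {x \<in> hpoly A I a b. a i \<bullet> x = b i}"
proof -
  let ?S = "hpoly A I a b"
  define J where "J = {i\<in>I. \<forall>x\<in>F. a i \<bullet> x = b i}"
  have F1: "F face_of ?S" "F \<noteq> ?S" and Fm: "\<And>G. G face_of ?S \<Longrightarrow> F \<subseteq> G \<Longrightarrow> G = F \<or> G = ?S"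
    using F by (auto simp: coatoms_def faces_def)
  have eq: "F = {x \<in> ?S. \<forall>i\<in>J. a i \<bullet> x = b i}"
    using face_of_hpoly_eq_tight[OF A I F1(1) F(2) J_def] .
  with F1 obtain i x where i: "i \<in> J" "x \<in> ?S" "a i \<bullet> x \<noteq> b i" by blast
  have "{x \<in> ?S. \<forall>j\<in>{i}. a j \<bullet> x = b j} face_of ?S"
    using i by (intro tight_face_of_hpoly A I) (auto simp: J_def)
  then have "{x \<in> ?S. \<forall>j\<in>{i}. a j \<bullet> x = b j} = F"
    using Fm i eq by blast
  then show ?thesis using i J_def by auto
qed

text \<open>The empty face lies below every face, so if it is a coatom it is the only one; a point
  is an example.\<close>

lemma coatoms_of_hpoly_subset:
  assumes "affine A" "finite I"
  shows "coatoms (hpoly A I a b) = {{}} \<or>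
    coatoms (hpoly A I a b) \<subseteq> (\<lambda>i. {x \<in> hpoly A I a b. a i \<bullet> x = b i}) ` I"
proof (cases "{} \<in> coatoms (hpoly A I a b)")
  case True
  then have "coatoms (hpoly A I a b) = {{}}"
    by (auto simp: coatoms_def faces_def)
  then show ?thesis by simp
next
  case False
  then have "F \<in> (\<lambda>i. {x \<in> hpoly A I a b. a i \<bullet> x = b i}) ` I" if "F \<in> coatoms (hpoly A I a b)" for F
    using nonempty_coatom_of_hpoly[OF assms that] that by blast
  then show ?thesis by blast
qed

text \<open>Points where only one inequality is tight make the sets \<open>?F i\<close> pairwise
  incomparable. A proper face above \<open>?F i\<close> lies in some \<open>?F j\<close>, and
  incomparability forces \<open>j = i\<close>.\<close>

lemma card_coatoms_hpoly:
  assumes A: "affine A" and I: "finite I" "card I \<ge> 2"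
    and w: "\<And>i. i \<in> I \<Longrightarrow> \<exists>x\<in>hpoly A I a b. \<forall>j\<in>I. a j \<bullet> x = b j \<longleftrightarrow> j = i"
  shows "card (coatoms (hpoly A I a b)) = card I"
proof -
  let ?S = "hpoly A I a b"
  let ?F = "\<lambda>i. {x \<in> ?S. a i \<bullet> x = b i}"
  from w obtain p where p: "\<And>i. i \<in> I \<Longrightarrow> p i \<in> ?S"
    "\<And>i j. i \<in> I \<Longrightarrow> j \<in> I \<Longrightarrow> a j \<bullet> p i = b j \<longleftrightarrow> j = i" by metis
  have le: "j = i" if "i \<in> I" "j \<in> I" "?F i \<subseteq> ?F j" for i j
    using p that by blast
  have "?F i \<in> coatoms ?S" if i: "i \<in> I" for i
  proof -
    have "?F i face_of ?S"
      using tight_face_of_hpoly[OF A I(1), of "{i}" a b] i by simp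
    \<comment> \<open>The witness of a second index lies outside \<open>?F i\<close>, which makes
      that face proper.\<close>
    moreover obtain k where "k \<in> I" "k \<noteq> i"
    proof -
      have "card {i} < card I" using I by simp
      then have "\<not> I \<subseteq> {i}" by (metis card_mono finite.emptyI finite_insert leD)
      then show ?thesis using that by blast
    qed
    then have "?F i \<noteq> ?S" using p i by blast
    moreover have "G = ?F i \<or> G = ?S" if G: "G face_of ?S" "?F i \<subseteq> G" for G
    proof (cases "G = ?S")
      case False
      have "G \<noteq> {}" using G p i by blast
      define J where "J = {i\<in>I. \<forall>x\<in>G. a i \<bullet> x = b i}"
      have eq: "G = {x \<in> ?S. \<forall>i\<in>J. a i \<bullet> x = b i}"
        using face_of_hpoly_eq_tight[OF A I(1) G(1) \<open>G \<noteq> {}\<close> J_def] .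
      with False obtain j where "j \<in> J" by blast
      then have "j \<in> I" "\<forall>x\<in>G. a j \<bullet> x = b j" by (simp_all add: J_def)
      then have "G \<subseteq> ?F j" using face_of_imp_subset[OF G(1)] by blast
      then have "?F i \<subseteq> ?F j" using G(2) by (meson order_trans)
      then have "j = i" by (rule le[OF i \<open>j \<in> I\<close>])
      then show ?thesis using \<open>G \<subseteq> ?F j\<close> G by blast
    qed simp
    ultimately show ?thesis unfolding coatoms_def faces_def by blast
  qed
  then have sub: "?F ` I \<subseteq> coatoms ?S" by blast
  obtain i where "i \<in> I" using I by (cases "I = {}") auto
  then have "p i \<in> ?F i" using p by simp
  moreover have "?F i \<in> coatoms ?S" using sub \<open>i \<in> I\<close> by (simp add: image_subset_iff)
  ultimately have "coatoms ?S \<noteq> {{}}" by (metis empty_iff singletonD)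
  then have "coatoms ?S \<subseteq> ?F ` I"
    using coatoms_of_hpoly_subset[OF A I(1), of a b] by blast
  with sub have "coatoms ?S = ?F ` I" by blast
  moreover have "inj_on ?F I"
    using le by (intro inj_onI) blast
  ultimately show ?thesis by (simp add: card_image)
qed

text \<open>Nonempty faces are given by sets of tight inequalities, so a bijection that preserves
  tightness carries faces to faces; it need not be affine.\<close>

lemma comb_equiv_hpoly_image:
  assumes I: "finite I"
    and h: "bij_betw h (hpoly UNIV I a b) (hpoly UNIV I c d)"
    and t: "\<And>x i. x \<in> hpoly UNIV I a b \<Longrightarrow> i \<in> I \<Longrightarrow> a i \<bullet> x = b i \<longleftrightarrow> c i \<bullet> h x = d i"
  shows "hpoly UNIV I a b \<simeq>\<^sub>c hpoly UNIV I c d"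
proof -
  let ?P = "hpoly UNIV I a b" and ?Q = "hpoly UNIV I c d"
  have inj: "inj_on h ?P" and im: "h ` ?P = ?Q" using h by (auto simp: bij_betw_def)
  have tight: "h ` {x \<in> ?P. \<forall>i\<in>J. a i \<bullet> x = b i} = {y \<in> ?Q. \<forall>i\<in>J. c i \<bullet> y = d i}"
    if "J \<subseteq> I" for J
    using t that unfolding im[symmetric] by (auto 0 3)
  have sub: "F \<subseteq> ?P" if "F \<in> faces ?P" for F
    using that by (auto simp: faces_def dest: face_of_imp_subset)
  have "h ` F \<in> faces ?Q" if F: "F \<in> faces ?P" for F
  proof (cases "F = {}")
    case False
    define J where "J = {i\<in>I. \<forall>x\<in>F. a i \<bullet> x = b i}"
    have eq: "F = {x \<in> ?P. \<forall>i\<in>J. a i \<bullet> x = b i}"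
      using face_of_hpoly_eq_tight[OF affine_UNIV I _ False J_def] F by (simp add: faces_def)
    have J: "J \<subseteq> I" by (auto simp: J_def)
    have "h ` F = {y \<in> ?Q. \<forall>i\<in>J. c i \<bullet> y = d i}"
      by (subst eq) (rule tight[OF J])
    then show ?thesis
      using tight_face_of_hpoly[OF affine_UNIV I J, of c d] by (simp add: faces_def)
  qed (auto simp: faces_def)
  moreover have "\<exists>F\<in>faces ?P. G = h ` F" if G: "G \<in> faces ?Q" for G
  proof (cases "G = {}")
    case False
    define J where "J = {i\<in>I. \<forall>x\<in>G. c i \<bullet> x = d i}"
    have eq: "G = {x \<in> ?Q. \<forall>i\<in>J. c i \<bullet> x = d i}"
      using face_of_hpoly_eq_tight[OF affine_UNIV I _ False J_def] G by (simp add: faces_def)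
    have J: "J \<subseteq> I" by (auto simp: J_def)
    show ?thesis
    proof
      show "G = h ` {x \<in> ?P. \<forall>i\<in>J. a i \<bullet> x = b i}"
        by (subst eq) (rule tight[OF J, symmetric])
      show "{x \<in> ?P. \<forall>i\<in>J. a i \<bullet> x = b i} \<in> faces ?P"
        using tight_face_of_hpoly[OF affine_UNIV I J, of a b] by (simp add: faces_def)
    qed
  qed (auto simp: faces_def)
  moreover have "inj_on ((`) h) (faces ?P)"
    using inj sub by (meson inj_onI inj_on_image_eq_iff)
  ultimately have "bij_betw ((`) h) (faces ?P) (faces ?Q)"
    unfolding bij_betw_def by blast
  then show ?thesis
    unfolding comb_equiv_def using inj sub by (metis inj_on_image_subset_iff)
qed

lemma hpoly_Int_affine: "hpoly UNIV I a b \<inter> H = hpoly H I a b"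
  by (auto simp: hpoly_def)

lemma affine_affine_hyperplane:
  assumes "H \<in> affine_hyperplanes" shows "affine H"
  using assms by (auto simp: affine_hyperplanes_def affine_hyperplane)

lemma full_dim_polytope_hpoly:
  fixes a :: "'i \<Rightarrow> 'a::euclidean_space"
  assumes I: "finite I" and bd: "bounded (hpoly UNIV I a b)"
    and x: "\<And>i. i \<in> I \<Longrightarrow> a i \<bullet> x < b i"
  shows "full_dim_polytope (hpoly UNIV I a b)"
proof -
  have "open (\<Inter>i\<in>I. {x. a i \<bullet> x < b i})"
    using I by (intro open_INT) (auto simp: open_halfspace_lt)
  moreover have "(\<Inter>i\<in>I. {x. a i \<bullet> x < b i}) \<subseteq> hpoly UNIV I a b"
    by (force simp: hpoly_def)
  ultimately have "x \<in> interior (hpoly UNIV I a b)"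
    using x by (intro interiorI[of "\<Inter>i\<in>I. {x. a i \<bullet> x < b i}"]) auto
  then have "aff_dim (hpoly UNIV I a b) = int DIM('a)"
    by (intro aff_dim_nonempty_interior) auto
  moreover have "polytope (hpoly UNIV I a b)"
    using bd polyhedron_hpoly[OF affine_UNIV I] by (simp add: polytope_eq_bounded_polyhedron)
  ultimately show ?thesis by (simp add: full_dim_polytope_def)
qed

lemma card_coatoms_hpoly_le:
  assumes "affine A" "finite I" "I \<noteq> {}"
  shows "card (coatoms (hpoly A I a b)) \<le> card I"
proof -
  have "card I \<ge> 1" using assms by (simp add: Suc_leI card_gt_0_iff)
  then show ?thesis
    using coatoms_of_hpoly_subset[OF assms(1,2), of a b] assms(2)
    by (auto intro: surj_card_le)
qed

lemma coatoms_singleton: "coatoms {v} = {{}}"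
  by (auto simp: coatoms_def faces_def dest: face_of_imp_subset)

lemma coatoms_empty: "coatoms {} = {}"
  by (auto simp: coatoms_def faces_def)

section \<open>Pointwise slice equivalence\<close>

text \<open>The empty set is the only convex set with a single face.\<close>

lemma comb_equiv_empty_iff:
  assumes "P \<simeq>\<^sub>c Q" "convex P" "convex Q"
  shows "P = {} \<longleftrightarrow> Q = {}"
proof -
  obtain \<phi> where "bij_betw \<phi> (faces P) (faces Q)"
    using assms by (auto simp: comb_equiv_def)
  then have "card (faces P) = card (faces Q)" by (rule bij_betw_same_card)
  moreover have "R = {} \<longleftrightarrow> card (faces R) = 1" if "convex R" for R :: "'c::euclidean_space set"
  proof
    assume "card (faces R) = 1"
    moreover have "{} \<in> faces R" "R \<in> faces R"
      using that by (auto simp: faces_def face_of_refl)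
    ultimately show "R = {}" by (metis card_1_singletonE singletonD)
  qed (simp add: faces_def)
  ultimately show ?thesis using assms by metis
qed

lemma slice_equiv_imp_subset:
  fixes P Q :: "'a::euclidean_space set"
  assumes P: "polytope P" and Q: "polytope Q" "Q \<noteq> {}" and eq: "pointwise_slice_equiv P Q"
  shows "P \<subseteq> Q"
proof
  fix x assume x: "x \<in> P"
  show "x \<in> Q"
  proof (rule ccontr)
    assume "x \<notin> Q"
    then obtain a b where ab: "a \<bullet> x < b" "\<forall>y\<in>Q. b < a \<bullet> y"
      using separating_hyperplane_closed_point[of Q x] Q polytope_imp_convex polytope_imp_closed
      by blast
    \<comment> \<open>The translate of the separating hyperplane through \<open>x\<close> meets
      \<open>P\<close> but not \<open>Q\<close>.\<close>
    let ?H = "{y. a \<bullet> y = a \<bullet> x}"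
    \<comment> \<open>A zero normal would give \<open>0 < b\<close> from \<open>x\<close> and
      \<open>b < 0\<close> from a point of \<open>Q\<close>.\<close>
    have "a \<noteq> 0" using ab Q by force
    then have "?H \<in> affine_hyperplanes" by (auto simp: affine_hyperplanes_def)
    then have "P \<inter> ?H \<simeq>\<^sub>c Q \<inter> ?H" using eq by (simp add: pointwise_slice_equiv_def)
    then have "P \<inter> ?H = {} \<longleftrightarrow> Q \<inter> ?H = {}"
      using P Q polytope_imp_convex
      by (intro comb_equiv_empty_iff) (auto intro!: convex_Int convex_hyperplane)
    moreover have "Q \<inter> ?H = {}" using ab by force
    ultimately show False using x by auto
  qed
qed

lemma pointwise_slice_equiv_iff_eq:
  fixes P Q :: "'a::euclidean_space set"
  assumes "full_dim_polytope P" "full_dim_polytope Q"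
  shows "pointwise_slice_equiv P Q \<longleftrightarrow> P = Q"
proof
  assume eq: "pointwise_slice_equiv P Q"
  then have "pointwise_slice_equiv Q P"
    by (simp add: pointwise_slice_equiv_def comb_equiv_sym)
  moreover have "P \<noteq> {}" "Q \<noteq> {}"
    using assms by (auto simp: full_dim_polytope_def)
  ultimately show "P = Q"
    using assms eq slice_equiv_imp_subset unfolding full_dim_polytope_def
    by (metis subset_antisym)
qed (simp add: pointwise_slice_equiv_def comb_equiv_refl)

section \<open>The crosspolytope and a skew realization\<close>

text \<open>Sign vectors are encoded by their sets of positive indices, so the type
  \<open>'n set\<close> indexes the \<open>2^d\<close> facets of the crosspolytope.\<close>

definition sg :: "'n set \<Rightarrow> 'n \<Rightarrow> real" where
  "sg \<sigma> i = (if i \<in> \<sigma> then 1 else -1)"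

lemma sg_mult_le: "sg \<sigma> i * t \<le> \<bar>t\<bar>"
  by (auto simp: sg_def)

lemma sg_mult_cases: "sg \<sigma> i * t = \<bar>t\<bar> \<or> sg \<sigma> i * t = - \<bar>t\<bar>"
  by (auto simp: sg_def)

definition octa_normal :: "'n::finite set \<Rightarrow> real ^ 'n" where
  "octa_normal \<sigma> = (\<chi> i. sg \<sigma> i)"

text \<open>For \<open>j \<noteq> k\<close>, the points with inner product 1 form the hyperplane
  through the vertices \<open>sg \<sigma> i\<close> times e_i for \<open>i \<noteq> k\<close> and
  the moved vertex, \<open>sg \<sigma> k\<close> times e_k plus e_j/2.\<close>

definition skew_normal :: "'n \<Rightarrow> 'n \<Rightarrow> 'n::finite set \<Rightarrow> real ^ 'n" where
  "skew_normal j k \<sigma> = octa_normal \<sigma> - axis k (sg \<sigma> j * sg \<sigma> k / 2)"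

definition octa :: "(real ^ 'n::finite) set" where
  "octa = hpoly UNIV UNIV octa_normal (\<lambda>_. 1)"

text \<open>For \<open>k \<noteq> j\<close> this is the crosspolytope with its two vertices \<open>\<plusminus>e\<^sub>k\<close> moved to \<open>\<plusminus>e\<^sub>k + e\<^sub>j/2\<close>.
  The axis through them misses the \<open>i\<close>-axis for \<open>i \<noteq> j, k\<close>, so a hyperplane can separate the two
  pairs of vertices and thereby cross all facets.\<close>

definition skew_octa :: "'n \<Rightarrow> 'n \<Rightarrow> (real ^ 'n::finite) set" where
  "skew_octa j k = hpoly UNIV UNIV (skew_normal j k) (\<lambda>_. 1)"

lemma octa_inner: "octa_normal \<sigma> \<bullet> x = (\<Sum>i\<in>UNIV. sg \<sigma> i * x $ i)"
  by (simp add: octa_normal_def inner_vec_def)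

lemma skew_inner: "skew_normal j k \<sigma> \<bullet> x = octa_normal \<sigma> \<bullet> x - sg \<sigma> j * sg \<sigma> k * x $ k / 2"
  by (simp add: skew_normal_def inner_diff_left inner_axis')

lemma octa_inner_le: "octa_normal \<sigma> \<bullet> x \<le> (\<Sum>i\<in>UNIV. \<bar>x $ i\<bar>)"
  unfolding octa_inner by (intro sum_mono sg_mult_le)

lemma octa_inner_sign: "octa_normal {i. 0 \<le> x $ i} \<bullet> x = (\<Sum>i\<in>UNIV. \<bar>x $ i\<bar>)"
  unfolding octa_inner by (intro sum.cong) (auto simp: sg_def)

text \<open>The largest signed sum is attained at the sign pattern of \<open>x\<close> and equals
  the l1 norm.\<close>

lemma mem_octa: "x \<in> octa \<longleftrightarrow> (\<Sum>i\<in>UNIV. \<bar>x $ i\<bar>) \<le> 1"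
proof
  assume "x \<in> octa"
  then have "octa_normal {i. 0 \<le> x $ i} \<bullet> x \<le> 1" unfolding octa_def hpoly_def by blast
  then show "(\<Sum>i\<in>UNIV. \<bar>x $ i\<bar>) \<le> 1" by (simp only: octa_inner_sign)
next
  assume "(\<Sum>i\<in>UNIV. \<bar>x $ i\<bar>) \<le> 1"
  then show "x \<in> octa" using octa_inner_le order_trans by (fastforce simp: octa_def hpoly_def)
qed

text \<open>No signed term exceeds its absolute value, so a signed sum of 1 inside the l1 unit ball
  leaves no room for a loss in any coordinate.\<close>

lemma octa_tight:
  assumes "x \<in> octa" "octa_normal \<sigma> \<bullet> x = 1"
  shows "sg \<sigma> i * x $ i = \<bar>x $ i\<bar>"
proof -
  have "(\<Sum>i\<in>UNIV. \<bar>x $ i\<bar> - sg \<sigma> i * x $ i) \<le> 0"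
    using assms by (simp add: mem_octa octa_inner sum_subtractf)
  moreover have "0 \<le> (\<Sum>i\<in>UNIV. \<bar>x $ i\<bar> - sg \<sigma> i * x $ i)"
    by (intro sum_nonneg) (simp add: sg_mult_le)
  ultimately have "(\<Sum>i\<in>UNIV. \<bar>x $ i\<bar> - sg \<sigma> i * x $ i) = 0" by simp
  then have "\<forall>i\<in>UNIV. \<bar>x $ i\<bar> - sg \<sigma> i * x $ i = 0"
    by (subst (asm) sum_nonneg_eq_0_iff) (auto simp: sg_mult_le)
  then show ?thesis by simp
qed

section \<open>Piecewise linear map from the crosspolytope to its skew realization\<close>

text \<open>Linear on each half-space given by the sign of \<open>x $ k\<close>. For
  \<open>j \<noteq> k\<close> it moves both vertices on the \<open>k\<close>-th axis by e_j/2 and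
  fixes the other vertices.\<close>

definition shift :: "'n \<Rightarrow> 'n \<Rightarrow> real ^ 'n::finite \<Rightarrow> real ^ 'n" where
  "shift j k x = x + (\<bar>x $ k\<bar> / 2) *\<^sub>R axis j 1"

text \<open>Corrects the sign at \<open>k\<close> to that of \<open>t\<close>, which will be
  \<open>x $ k\<close>; of the two sign vectors differing only there, this one has the larger signed
  sum, up to ties.\<close>

definition fix_sign :: "'n \<Rightarrow> 'n set \<Rightarrow> real \<Rightarrow> 'n set" where
  "fix_sign k \<sigma> t = (if t \<ge> 0 then insert k \<sigma> else \<sigma> - {k})"

lemma sg_fix_sign: "sg (fix_sign k \<sigma> t) i = (if i = k then (if t \<ge> 0 then 1 else -1) else sg \<sigma> i)"
  by (auto simp: sg_def fix_sign_def)

lemma octa_inner_fix_sign: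
  "octa_normal (fix_sign k \<sigma> (x $ k)) \<bullet> x = octa_normal \<sigma> \<bullet> x + \<bar>x $ k\<bar> - sg \<sigma> k * x $ k"
proof -
  have "octa_normal \<tau> \<bullet> x = sg \<tau> k * x $ k + (\<Sum>i\<in>UNIV - {k}. sg \<tau> i * x $ i)" for \<tau>
    unfolding octa_inner by (rule sum.remove) auto
  moreover have "(\<Sum>i\<in>UNIV - {k}. sg (fix_sign k \<sigma> (x $ k)) i * x $ i)
      = (\<Sum>i\<in>UNIV - {k}. sg \<sigma> i * x $ i)"
    by (intro sum.cong) (auto simp: sg_fix_sign)
  ultimately show ?thesis by (auto simp: sg_fix_sign)
qed

lemma shift_nth: "shift j k x $ i = x $ i + (if i = j then \<bar>x $ k\<bar> / 2 else 0)"
  by (simp add: shift_def axis_def)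

lemma skew_inner_shift:
  assumes "j \<noteq> k"
  shows "skew_normal j k \<sigma> \<bullet> shift j k x
    = octa_normal \<sigma> \<bullet> x + sg \<sigma> j * (\<bar>x $ k\<bar> - sg \<sigma> k * x $ k) / 2"
proof -
  have "octa_normal \<sigma> \<bullet> shift j k x = octa_normal \<sigma> \<bullet> x + sg \<sigma> j * \<bar>x $ k\<bar> / 2"
    by (simp add: shift_def inner_add_right inner_axis octa_normal_def)
  then show ?thesis using assms
    by (simp add: skew_inner shift_nth field_simps)
qed

text \<open>With the right sign at \<open>k\<close>, both systems give the same value at
  corresponding points. With the wrong sign and \<open>m = \<bar>x $ k\<bar> > 0\<close>, the value
  for the corrected sign exceeds the crosspolytope value by \<open>2 * m\<close> and the skew value
  by at least \<open>m\<close>, so neither inequality can be tight on the polytope.\<close>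

lemma skew_inner_shift_bounds:
  assumes "j \<noteq> k"
  defines "\<sigma>' \<equiv> \<lambda>\<sigma> x. fix_sign k \<sigma> (x $ k)"
  shows "skew_normal j k (\<sigma>' \<sigma> x) \<bullet> shift j k x = octa_normal (\<sigma>' \<sigma> x) \<bullet> x"
    and "sg \<sigma> k * x $ k = \<bar>x $ k\<bar> \<Longrightarrow> skew_normal j k \<sigma> \<bullet> shift j k x = octa_normal \<sigma> \<bullet> x"
    and "sg \<sigma> k * x $ k \<noteq> \<bar>x $ k\<bar> \<Longrightarrow>
      octa_normal \<sigma> \<bullet> x < octa_normal (\<sigma>' \<sigma> x) \<bullet> x \<and>
      skew_normal j k \<sigma> \<bullet> shift j k x < octa_normal (\<sigma>' \<sigma> x) \<bullet> x"
proof -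
  show "skew_normal j k (\<sigma>' \<sigma> x) \<bullet> shift j k x = octa_normal (\<sigma>' \<sigma> x) \<bullet> x"
    by (simp add: skew_inner_shift[OF assms(1)] \<sigma>'_def sg_fix_sign)
  show "sg \<sigma> k * x $ k = \<bar>x $ k\<bar> \<Longrightarrow> skew_normal j k \<sigma> \<bullet> shift j k x = octa_normal \<sigma> \<bullet> x"
    by (simp add: skew_inner_shift[OF assms(1)])
  assume *: "sg \<sigma> k * x $ k \<noteq> \<bar>x $ k\<bar>"
  then have "sg \<sigma> k * x $ k = - \<bar>x $ k\<bar>" using sg_mult_cases[of \<sigma> k "x $ k"] by simp
  moreover have "0 < \<bar>x $ k\<bar>" using * by (auto simp: sg_def)
  ultimately show "octa_normal \<sigma> \<bullet> x < octa_normal (\<sigma>' \<sigma> x) \<bullet> x \<and>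
      skew_normal j k \<sigma> \<bullet> shift j k x < octa_normal (\<sigma>' \<sigma> x) \<bullet> x"
    unfolding skew_inner_shift[OF assms(1)] \<sigma>'_def octa_inner_fix_sign
    by (cases "j \<in> \<sigma>") (auto simp: sg_def)
qed

text \<open>Both memberships are governed by the sign vectors correct at \<open>k\<close>, where the
  two systems agree; all others have smaller values in both.\<close>

lemma shift_mem_skew_octa_iff:
  assumes jk: "j \<noteq> k"
  shows "shift j k x \<in> skew_octa j k \<longleftrightarrow> x \<in> octa"
proof
  assume x: "shift j k x \<in> skew_octa j k"
  have "octa_normal \<sigma> \<bullet> x \<le> octa_normal (fix_sign k \<sigma> (x $ k)) \<bullet> x" for \<sigma>
    unfolding octa_inner_fix_sign using sg_mult_le[of \<sigma> k "x $ k"] by simp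
  moreover have "octa_normal (fix_sign k \<sigma> (x $ k)) \<bullet> x \<le> 1" for \<sigma>
    using x by (simp add: skew_octa_def hpoly_def flip: skew_inner_shift_bounds(1)[OF jk])
  ultimately show "x \<in> octa" unfolding octa_def hpoly_def by (auto intro: order_trans)
next
  assume x: "x \<in> octa"
  then have le: "octa_normal \<tau> \<bullet> x \<le> 1" for \<tau> by (simp add: octa_def hpoly_def)
  have "skew_normal j k \<sigma> \<bullet> shift j k x \<le> 1" for \<sigma>
    using skew_inner_shift_bounds(2,3)[OF jk, of \<sigma> x] le[of \<sigma>] le[of "fix_sign k \<sigma> (x $ k)"]
    by (cases "sg \<sigma> k * x $ k = \<bar>x $ k\<bar>") auto
  then show "shift j k x \<in> skew_octa j k" by (simp add: skew_octa_def hpoly_def)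
qed

lemma skew_tight_shift_iff:
  assumes jk: "j \<noteq> k" and x: "x \<in> octa"
  shows "skew_normal j k \<sigma> \<bullet> shift j k x = 1 \<longleftrightarrow> octa_normal \<sigma> \<bullet> x = 1"
proof -
  have le: "octa_normal \<tau> \<bullet> x \<le> 1" for \<tau> using x by (simp add: octa_def hpoly_def)
  show ?thesis
    using skew_inner_shift_bounds(2,3)[OF jk, of \<sigma> x] le[of "fix_sign k \<sigma> (x $ k)"]
    by (cases "sg \<sigma> k * x $ k = \<bar>x $ k\<bar>") auto
qed

lemma shift_surj:
  assumes "j \<noteq> k"
  shows "shift j k (y - (\<bar>y $ k\<bar> / 2) *\<^sub>R axis j 1) = y"
  using assms by (simp add: vec_eq_iff shift_nth) (simp add: axis_def)

lemma bij_betw_shift: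
  assumes jk: "j \<noteq> k"
  shows "bij_betw (shift j k) octa (skew_octa j k)"
proof -
  have "inj (shift j k)"
  proof (rule injI)
    fix x y assume eq: "shift j k x = shift j k y"
    then have "x $ k = y $ k" using shift_nth[of j k x k] shift_nth[of j k y k] jk by simp
    then show "x = y" using eq by (simp add: shift_def)
  qed
  moreover have "shift j k ` octa = skew_octa j k"
    using shift_mem_skew_octa_iff[OF jk] shift_surj[OF jk] by (auto simp: image_iff) metis
  ultimately show ?thesis unfolding bij_betw_def by (metis inj_on_subset subset_UNIV)
qed

lemma octa_comb_equiv_skew_octa:
  fixes j k :: "'n::finite"
  assumes "j \<noteq> k"
  shows "(octa :: (real ^ 'n) set) \<simeq>\<^sub>c skew_octa j k"
  unfolding octa_def skew_octa_def
proof (rule comb_equiv_hpoly_image)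
  show "bij_betw (shift j k) (hpoly UNIV UNIV octa_normal (\<lambda>_. 1))
      (hpoly UNIV UNIV (skew_normal j k) (\<lambda>_. 1))"
    using bij_betw_shift[OF assms] by (simp add: octa_def skew_octa_def)
qed (use skew_tight_shift_iff[OF assms] in \<open>auto simp: octa_def\<close>)

lemma bounded_octa: "bounded octa"
  unfolding bounded_iff using norm_le_l1_cart mem_octa by (metis order_trans)

lemma bounded_skew_octa:
  assumes "j \<noteq> k"
  shows "bounded (skew_octa j k)"
proof -
  have "norm (shift j k x) \<le> 2" if x: "x \<in> octa" for x
  proof -
    have n: "norm x \<le> 1" using x norm_le_l1_cart[of x] by (simp add: mem_octa)
    have "norm (shift j k x) \<le> norm x + \<bar>x $ k\<bar> / 2"
      unfolding shift_def by (rule order_trans[OF norm_triangle_ineq]) simp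
    then show ?thesis using n component_le_norm_cart[of x k] by simp
  qed
  moreover have "skew_octa j k = shift j k ` octa"
    using bij_betw_shift[OF assms] by (simp add: bij_betw_def)
  ultimately show ?thesis unfolding bounded_iff by (intro exI[of _ 2]) simp
qed

lemma full_dim_octa: "full_dim_polytope octa"
  unfolding octa_def using bounded_octa
  by (intro full_dim_polytope_hpoly[where x = 0]) (auto simp: octa_def)

lemma full_dim_skew_octa: "j \<noteq> k \<Longrightarrow> full_dim_polytope (skew_octa j k)"
  unfolding skew_octa_def using bounded_skew_octa[of j k]
  by (intro full_dim_polytope_hpoly[where x = 0]) (auto simp: skew_octa_def)

section \<open>Facets of slices of the two realizations\<close>

text \<open>With \<open>2^d\<close> coatoms all sets \<open>F \<sigma>\<close> would be distinct
  coatoms. For the sign vector opposite to the normal of \<open>H\<close>, some coordinate vanishes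
  on \<open>F \<sigma>\<close>; flipping its sign gives another coatom containing
  \<open>F \<sigma>\<close>, which is impossible.\<close>

lemma card_coatoms_octa_slice:
  fixes H :: "(real ^ 'n::finite) set"
  assumes H: "H \<in> affine_hyperplanes" and n: "CARD('n) \<ge> 2"
  shows "card (coatoms (octa \<inter> H)) \<noteq> 2 ^ CARD('n)"
proof
  assume card: "card (coatoms (octa \<inter> H)) = 2 ^ CARD('n)"
  define F where "F = (\<lambda>\<sigma>. {x \<in> octa \<inter> H. octa_normal \<sigma> \<bullet> x = 1})"
  have cardI: "card (UNIV :: 'n set set) = 2 ^ CARD('n)"
    using card_Pow[of "UNIV :: 'n set"] by simp
  have "(2::nat) ^ 1 \<le> 2 ^ CARD('n)" using n by (intro power_increasing) auto
  then have "card (coatoms (octa \<inter> H)) \<noteq> card {{}::(real ^ 'n) set}" unfolding card by simp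
  then have "coatoms (octa \<inter> H) \<noteq> {{}}" by metis
  then have sub: "coatoms (octa \<inter> H) \<subseteq> range F"
    using coatoms_of_hpoly_subset[OF affine_affine_hyperplane[OF H], of UNIV octa_normal "\<lambda>_. 1"]
    by (simp add: octa_def hpoly_Int_affine F_def)
  \<comment> \<open>\<open>F\<close> has at most \<open>2^d\<close> values, so the count forces
    equality here and injectivity below.\<close>
  have eq: "coatoms (octa \<inter> H) = range F"
    using card_image_le[of UNIV F] by (intro card_seteq sub) (auto simp: card cardI)
  then have inj: "inj F"
    using card cardI by (intro eq_card_imp_inj_on) simp_all
  obtain \<alpha> \<gamma> where "\<alpha> \<noteq> 0" "H = {x. \<alpha> \<bullet> x = \<gamma>}" using H by (auto simp: affine_hyperplanes_def)
  \<comment> \<open>Negating the equation leaves the hyperplane unchanged, so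
    \<open>\<gamma>\<close> may be taken nonnegative.\<close>
  then obtain \<alpha> \<gamma> where H: "\<alpha> \<noteq> 0" "H = {x. \<alpha> \<bullet> x = \<gamma>}" "0 \<le> \<gamma>"
    by (cases "0 \<le> \<gamma>") (auto intro: that[of "- \<alpha>" "- \<gamma>"] that)
  \<comment> \<open>On this facet every term \<open>\<alpha> $ l * x $ l\<close> is at most 0, while
    the terms sum to \<open>\<gamma> \<ge> 0\<close>; so all of them vanish.\<close>
  define \<sigma> where "\<sigma> = {i. \<alpha> $ i \<le> 0}"
  obtain i where i: "\<alpha> $ i \<noteq> 0" using H(1) by (auto simp: vec_eq_iff)
  have zero: "x $ i = 0" if x: "x \<in> F \<sigma>" for x
  proof -
    have s: "sg \<sigma> l * x $ l = \<bar>x $ l\<bar>" for l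
      using x octa_tight by (auto simp: F_def)
    have neg: "\<alpha> $ l * x $ l = - (\<bar>\<alpha> $ l\<bar> * \<bar>x $ l\<bar>)" for l
      using s[of l] by (auto simp: sg_def \<sigma>_def abs_if split: if_splits)
    have "0 \<le> (\<Sum>l\<in>UNIV. \<alpha> $ l * x $ l)"
      using x H by (simp add: F_def inner_vec_def)
    then have "(\<Sum>l\<in>UNIV. \<bar>\<alpha> $ l\<bar> * \<bar>x $ l\<bar>) \<le> 0" by (simp add: neg sum_negf)
    then have "(\<Sum>l\<in>UNIV. \<bar>\<alpha> $ l\<bar> * \<bar>x $ l\<bar>) = 0"
      by (intro antisym sum_nonneg) auto
    then have "\<bar>\<alpha> $ i\<bar> * \<bar>x $ i\<bar> = 0"
      by (subst (asm) sum_nonneg_eq_0_iff) auto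
    then show ?thesis using i by simp
  qed
  define \<tau> where "\<tau> = (if i \<in> \<sigma> then \<sigma> - {i} else insert i \<sigma>)"
  have "octa_normal \<tau> \<bullet> x = octa_normal \<sigma> \<bullet> x" if "x $ i = 0" for x
    unfolding octa_inner using that by (intro sum.cong) (auto simp: sg_def \<tau>_def)
  then have "F \<sigma> \<subseteq> F \<tau>" using zero by (auto simp: F_def)
  moreover have c: "F \<sigma> \<in> coatoms (octa \<inter> H)" "F \<tau> \<in> coatoms (octa \<inter> H)" using eq by auto
  ultimately have "F \<tau> = F \<sigma>"
    unfolding coatoms_def by blast
  then have "\<tau> = \<sigma>" using inj by (simp add: inj_eq)
  then show False by (auto simp: \<tau>_def split: if_splits)
qed

text \<open>The moved vertices have \<open>j\<close>-th coordinate 1/2, and those on the axes other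
  than \<open>j\<close> and \<open>k\<close>, which exist in dimension at least 3, have 0. Every
  facet contains vertices of both kinds, so the level 1/4 crosses its relative interior.\<close>

lemma card_coatoms_skew_octa_slice:
  fixes j k :: "'n::finite"
  assumes jk: "j \<noteq> k" and n: "CARD('n) \<ge> 3"
  shows "card (coatoms (skew_octa j k \<inter> {x. axis j 1 \<bullet> x = 1/4})) = 2 ^ CARD('n)"
proof -
  let ?H = "{x. axis j 1 \<bullet> x = 1/4} :: (real ^ 'n) set"
  have cardI: "card (UNIV :: 'n set set) = 2 ^ CARD('n)"
    using card_Pow[of "UNIV :: 'n set"] by simp
  have "(2::nat) ^ CARD('n) \<ge> 2 ^ 1" using n by (intro power_increasing) auto
  moreover have "\<exists>y\<in>skew_octa j k \<inter> ?H. \<forall>\<tau>. skew_normal j k \<tau> \<bullet> y = 1 \<longleftrightarrow> \<tau> = \<sigma>" for \<sigma>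
  proof -
    \<comment> \<open>Weights of a point inside the facet \<open>\<sigma>\<close> of the
      crosspolytope, chosen so that the shifted \<open>j\<close>-th coordinate is 1/4, as
      \<open>1/8 + (1/4)/2\<close> or \<open>-1/8 + (3/4)/2\<close>. The rest is positive, as
      \<open>ck < 7/8\<close>, and is spread evenly over the other coordinates.\<close>
    define ck :: real where "ck = (if j \<in> \<sigma> then 1/4 else 3/4)"
    define c where "c = (\<lambda>i. if i = k then ck else if i = j then 1/8
      else (7/8 - ck) / (real CARD('n) - 2))"
    define x where "x = (\<chi> i. sg \<sigma> i * c i)"
    have pos: "c i > 0" for i using n by (auto simp: c_def ck_def)
    have ab: "\<bar>x $ i\<bar> = c i" for i using pos[of i] by (auto simp: x_def sg_def abs_mult)
    have "card (UNIV - {j, k}) = CARD('n) - 2"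
      using jk by (subst card_Diff_subset) auto
    then have "(\<Sum>i\<in>UNIV - {j, k}. c i) = 7/8 - ck"
      using n by (simp add: c_def of_nat_diff)
    moreover have "(\<Sum>i\<in>UNIV. c i) = (\<Sum>i\<in>UNIV - {j, k}. c i) + (\<Sum>i\<in>{j, k}. c i)"
      by (rule sum.subset_diff) auto
    ultimately have sum: "(\<Sum>i\<in>UNIV. c i) = 1" using jk by (simp add: c_def)
    then have xo: "x \<in> octa" by (simp add: mem_octa ab)
    have "octa_normal \<sigma> \<bullet> x = 1"
      unfolding octa_inner sum[symmetric] by (intro sum.cong) (auto simp: x_def sg_def)
    moreover have "\<tau> = \<sigma>" if "octa_normal \<tau> \<bullet> x = 1" for \<tau>
    proof -
      have "i \<in> \<tau> \<longleftrightarrow> i \<in> \<sigma>" for i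
        using octa_tight[OF xo that, of i] ab[of i] pos[of i]
        by (auto simp: x_def sg_def split: if_splits)
      then show ?thesis by blast
    qed
    ultimately have "skew_normal j k \<tau> \<bullet> shift j k x = 1 \<longleftrightarrow> \<tau> = \<sigma>" for \<tau>
      using skew_tight_shift_iff[OF jk xo] by blast
    moreover have "shift j k x \<in> skew_octa j k"
      using shift_mem_skew_octa_iff[OF jk] xo by blast
    moreover have "shift j k x $ j = 1/4"
      using jk ab[of k] by (auto simp: shift_nth x_def c_def ck_def sg_def)
    ultimately show ?thesis by (auto simp: inner_axis')
  qed
  ultimately show ?thesis
    unfolding skew_octa_def hpoly_Int_affine cardI[symmetric]
    by (intro card_coatoms_hpoly affine_hyperplane) (simp_all add: cardI)
qed

lemma octa_not_setwise_slice_equiv_skew_octa: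
  fixes j k :: "'n::finite"
  assumes jk: "j \<noteq> k" and n: "CARD('n) \<ge> 3"
  shows "\<not> setwise_slice_equiv octa (skew_octa j k)"
proof
  let ?H = "{x. axis j 1 \<bullet> x = 1/4} :: (real ^ 'n) set"
  assume "setwise_slice_equiv octa (skew_octa j k)"
  moreover have H: "?H \<in> affine_hyperplanes" unfolding affine_hyperplanes_def
    by (intro CollectI exI[of _ "axis j 1 :: real ^ 'n"] exI[of _ "1/4"]) (simp add: axis_eq_0_iff)
  ultimately obtain H' where H': "H' \<in> affine_hyperplanes"
      "comb_type (skew_octa j k \<inter> ?H) = comb_type (octa \<inter> H')"
    unfolding setwise_slice_equiv_def by blast
  have p: "polytope (skew_octa j k \<inter> ?H)" "polytope (octa \<inter> H')"
    using full_dim_octa full_dim_skew_octa[OF jk] H' H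
    by (auto simp: full_dim_polytope_def intro!: polytope_Int_polyhedron affine_imp_polyhedron
        affine_affine_hyperplane)
  then have "skew_octa j k \<inter> ?H \<simeq>\<^sub>c octa \<inter> H'"
    using H'(2) comb_type_eq_iff by blast
  then have "card (coatoms (skew_octa j k \<inter> ?H)) = card (coatoms (octa \<inter> H'))"
    using p polytope_imp_convex by (intro card_coatoms_comb_equiv) auto
  then show False
    using card_coatoms_skew_octa_slice[OF jk n] card_coatoms_octa_slice[OF H'(1)] n by simp
qed

section \<open>Polytopes of dimension at most two\<close>

text \<open>For \<open>n = 2\<close> the two pairs collapse to a single edge, as in a segment; the
  guard removes the loop that \<open>n = 1\<close> would give, as in a point.\<close>

definition cycle_edges :: "nat \<Rightarrow> nat set set" where
  "cycle_edges n = (if n < 2 then {} else (\<lambda>i. {i, (i + 1) mod n}) ` {..<n})"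

lemma cycle_edges_small:
  "cycle_edges 3 = {{0, 1}, {1, 2}, {2, 0}}"
  "cycle_edges 4 = {{0, 1}, {1, 2}, {2, 3}, {3, 0}}"
  "cycle_edges 5 = {{0, 1}, {1, 2}, {2, 3}, {3, 4}, {4, 0}}"
proof -
  have "{..<3::nat} = {0, 1, 2}" "{..<4::nat} = {0, 1, 2, 3}" "{..<5::nat} = {0, 1, 2, 3, 4}"
    by auto
  then show "cycle_edges 3 = {{0, 1}, {1, 2}, {2, 0}}"
    "cycle_edges 4 = {{0, 1}, {1, 2}, {2, 3}, {3, 0}}"
    "cycle_edges 5 = {{0, 1}, {1, 2}, {2, 3}, {3, 4}, {4, 0}}"
    by (simp_all add: cycle_edges_def del: One_nat_def)
qed

text \<open>From a vertex \<open>v\<close> with neighbours \<open>a\<close> and \<open>b\<close>,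
  the second neighbours \<open>c\<close> of \<open>a\<close> and \<open>d\<close> of
  \<open>b\<close> decide the length: \<open>c = b\<close> gives 3, \<open>c = d\<close> gives 4,
  and otherwise five distinct vertices exhaust \<open>V\<close>.\<close>

lemma two_regular_cycle:
  assumes fin: "finite V" and V0: "V \<noteq> {}" and V5: "card V \<le> 5"
    and E: "\<And>e. e \<in> E \<Longrightarrow> e \<subseteq> V \<and> card e = 2"
    and deg: "\<And>v. v \<in> V \<Longrightarrow> card {e \<in> E. v \<in> e} = 2"
  shows "\<exists>f. bij_betw f {..<card V} V \<and> E = (`) f ` cycle_edges (card V)"
proof -
  have nb: "\<exists>a b. a \<noteq> b \<and> a \<noteq> v \<and> b \<noteq> v \<and> a \<in> V \<and> b \<in> V \<and> (\<forall>x. {v, x} \<in> E \<longleftrightarrow> x = a \<or> x = b)"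
    if v: "v \<in> V" for v
  proof -
    obtain e1 e2 where e: "{e \<in> E. v \<in> e} = {e1, e2}" "e1 \<noteq> e2"
      using deg[OF v] by (meson card_2_iff)
    have "\<exists>a. a \<noteq> v \<and> a \<in> V \<and> e = {v, a}" if "e \<in> {e \<in> E. v \<in> e}" for e
    proof -
      have e: "e \<subseteq> V" "card e = 2" "v \<in> e" using that E[of e] by auto
      then obtain p q where "e = {p, q}" "p \<noteq> q" by (meson card_2_iff)
      then show ?thesis using e by auto
    qed
    then obtain a b where ab: "a \<noteq> v" "a \<in> V" "e1 = {v, a}" "b \<noteq> v" "b \<in> V" "e2 = {v, b}"
      using e by (metis insertI1 insert_commute)
    have "{v, x} \<in> E \<longleftrightarrow> x = a \<or> x = b" for x
    proof -
      have "{v, x} \<in> E \<longleftrightarrow> {v, x} \<in> {e1, e2}" unfolding e(1)[symmetric] by simp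
      then show ?thesis using ab by (auto simp: doubleton_eq_iff)
    qed
    then show ?thesis using ab e(2) by blast
  qed
  have other: "\<exists>b. b \<noteq> a \<and> b \<noteq> v \<and> b \<in> V \<and> (\<forall>x. {v, x} \<in> E \<longleftrightarrow> x = a \<or> x = b)"
    if v: "v \<in> V" and "{a, v} \<in> E" for a v
  proof -
    have "{v, a} \<in> E" using that by (simp add: insert_commute)
    then show ?thesis using nb[OF v] by metis
  qed
  \<comment> \<open>A vertex outside a set closed under adjacency brings two neighbours that are
    also outside, and 3 + 3 exceeds the bound 5.\<close>
  have closed: "V = W" if W: "W \<subseteq> V" "card W \<ge> 3" and cl: "\<And>w x. w \<in> W \<Longrightarrow> {w, x} \<in> E \<Longrightarrow> x \<in> W" for W
  proof (rule ccontr)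
    assume "V \<noteq> W"
    then obtain p where p: "p \<in> V" "p \<notin> W" using W by blast
    then obtain a b where ab: "a \<noteq> b" "a \<noteq> p" "b \<noteq> p" "a \<in> V" "b \<in> V" "{p, a} \<in> E" "{p, b} \<in> E"
      using nb by metis
    have "a \<notin> W" "b \<notin> W" using cl[of a p] cl[of b p] ab p by (auto simp: insert_commute)
    then have "card (W \<union> {p, a, b}) = card W + 3"
      using ab p W finite_subset[OF _ fin] by (subst card_Un_disjoint) auto
    moreover have "card (W \<union> {p, a, b}) \<le> card V"
      using ab p W fin by (intro card_mono) auto
    ultimately show False using W V5 by simp
  qed
  have Eeq: "E = S" if S: "\<forall>e\<in>S. e \<in> E" "\<forall>v\<in>V. \<forall>x. {v, x} \<in> E \<longrightarrow> {v, x} \<in> S" for S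
  proof
    show "E \<subseteq> S"
    proof
      fix e assume e: "e \<in> E"
      then obtain p q where "e = {p, q}" "p \<in> V" using E[of e] by (auto simp: card_2_iff)
      then show "e \<in> S" using e S(2) by simp
    qed
  qed (use S(1) in blast)
  obtain v where v: "v \<in> V" using V0 by blast
  then obtain a b where ab: "a \<noteq> b" "a \<noteq> v" "b \<noteq> v" "a \<in> V" "b \<in> V"
      and Nv: "\<And>x. {v, x} \<in> E \<longleftrightarrow> x = a \<or> x = b" using nb by metis
  obtain c where c: "c \<noteq> v" "c \<noteq> a" "c \<in> V" and Na: "\<And>x. {a, x} \<in> E \<longleftrightarrow> x = v \<or> x = c"
    using other[of a v] ab Nv by metis
  obtain d where d: "d \<noteq> v" "d \<noteq> b" "d \<in> V" and Nb: "\<And>x. {b, x} \<in> E \<longleftrightarrow> x = v \<or> x = d"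
    using other[of b v] ab Nv by metis
  have sym: "{x, y} \<in> E \<longleftrightarrow> {y, x} \<in> E" for x y by (simp add: insert_commute)
  consider (tri) "c = b" | (quad) "c \<noteq> b" "d = c" | (pent) "c \<noteq> b" "d \<noteq> c" by blast
  then show ?thesis
  proof cases
    case tri
    then have "d = a" using Na[of b] Nb[of a] sym[of a b] ab by auto
    have V: "V = {v, a, b}"
      using ab v Nv Na Nb tri \<open>d = a\<close> by (intro closed) auto
    then have cardV: "card V = 3" using ab by auto
    \<comment> \<open>The list runs once round the cycle, here and in the other cases.\<close>
    define f where "f = (!) [v, a, b]"
    have "E = {{v, a}, {a, b}, {b, v}}"
      using Nv Na Nb tri \<open>d = a\<close> V by (intro Eeq) (auto simp: insert_commute)
    then have "E = (`) f ` cycle_edges (card V)"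
      unfolding cardV f_def cycle_edges_small by simp
    moreover have "bij_betw f {..<card V} V"
      unfolding f_def using ab V by (intro bij_betw_nth) (auto simp: cardV)
    ultimately show ?thesis using cardV by auto
  next
    case quad
    have Nc: "{c, x} \<in> E \<longleftrightarrow> x = a \<or> x = b" for x
      using other[of c a] Na[of c] Nb[of c] c sym[of c b] quad ab by metis
    have V: "V = {v, a, b, c}"
      using ab c d v Nv Na Nb Nc quad by (intro closed) auto
    then have cardV: "card V = 4" using ab c d quad by auto
    define f where "f = (!) [v, a, c, b]"
    have "E = {{v, a}, {a, c}, {c, b}, {b, v}}"
      using Nv Na Nb Nc quad V by (intro Eeq) (auto simp: insert_commute)
    then have "E = (`) f ` cycle_edges (card V)"
      unfolding cardV f_def cycle_edges_small by simp
    moreover have "bij_betw f {..<card V} V"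
      unfolding f_def using ab c d V quad by (intro bij_betw_nth) (auto simp: cardV)
    ultimately show ?thesis using cardV by auto
  next
    case pent
    have "d \<noteq> a" using Na[of b] Nb[of a] sym[of a b] ab pent by auto
    have "card {v, a, b, c, d} = 5" using ab c d pent \<open>d \<noteq> a\<close> by auto
    then have V: "V = {v, a, b, c, d}"
      using ab c d v V5 by (intro card_seteq[symmetric] fin) auto
    have cardV: "card V = 5" unfolding V by fact
    \<comment> \<open>The vertices \<open>v\<close> and \<open>b\<close> already have both their
      neighbours, so the second neighbour of \<open>c\<close> can only be \<open>d\<close>.\<close>
    obtain x where x: "x \<noteq> a" "x \<noteq> c" "x \<in> V" and Nc': "\<And>y. {c, y} \<in> E \<longleftrightarrow> y = a \<or> y = x"
      using other[of c a] Na c by metis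
    have "x \<noteq> v" using Nc'[of v] Nv[of c] sym[of c v] c pent by auto
    moreover have "x \<noteq> b" using Nc'[of b] Nb[of c] sym[of c b] c pent by auto
    ultimately have Nc: "\<And>y. {c, y} \<in> E \<longleftrightarrow> y = a \<or> y = d" using Nc' x V by auto
    obtain z where Nd': "\<And>y. {d, y} \<in> E \<longleftrightarrow> y = b \<or> y = z"
      using other[of d b] Nb d by metis
    have "z = c" using Nd'[of c] Nc[of d] sym[of c d] pent by auto
    then have Nd: "\<And>y. {d, y} \<in> E \<longleftrightarrow> y = b \<or> y = c" using Nd' by auto
    define f where "f = (!) [v, a, c, d, b]"
    have "E = {{v, a}, {a, c}, {c, d}, {d, b}, {b, v}}"
      using Nv Na Nb Nc Nd V by (intro Eeq) (auto simp: insert_commute)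
    then have "E = (`) f ` cycle_edges (card V)"
      unfolding cardV f_def cycle_edges_small by simp
    moreover have "bij_betw f {..<card V} V"
      unfolding f_def using ab c d V pent \<open>d \<noteq> a\<close> by (intro bij_betw_nth) (auto simp: cardV)
    ultimately show ?thesis using cardV by auto
  qed
qed

section \<open>Face lattices recovered from vertices and edges\<close>

definition vertices :: "'a::euclidean_space set \<Rightarrow> 'a set" where
  "vertices P = {x. x extreme_point_of P}"

definition edges :: "'a::euclidean_space set \<Rightarrow> 'a set set" where
  "edges P = {F \<in> faces P. aff_dim F = 1}"

lemma polytope_face: "polytope P \<Longrightarrow> F \<in> faces P \<Longrightarrow> polytope F"
  by (simp add: faces_def face_of_polytope_polytope)

lemma vertices_face: "F \<in> faces P \<Longrightarrow> vertices F = vertices P \<inter> F"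
  by (auto simp: vertices_def faces_def extreme_point_of_face)

lemma polytope_eq_hull_vertices: "polytope P \<Longrightarrow> P = convex hull (vertices P)"
  unfolding vertices_def
  by (intro Krein_Milman_Minkowski polytope_imp_compact polytope_imp_convex)

lemma finite_vertices: "polytope P \<Longrightarrow> finite (vertices P)"
  unfolding vertices_def by (intro finite_polyhedron_extreme_points polytope_imp_polyhedron)

lemma vertices_subset: "vertices P \<subseteq> P"
  by (auto simp: vertices_def extreme_point_of_def)

text \<open>A face of a polytope is the convex hull of its vertices.\<close>

lemma vertices_subset_iff:
  assumes "polytope P" "F \<in> faces P" "G \<in> faces P"
  shows "vertices F \<subseteq> vertices G \<longleftrightarrow> F \<subseteq> G"
proof
  assume "vertices F \<subseteq> vertices G"
  then show "F \<subseteq> G"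
    using polytope_eq_hull_vertices polytope_face assms by (metis hull_mono)
next
  assume "F \<subseteq> G"
  then show "vertices F \<subseteq> vertices G" using assms by (auto simp: vertices_face)
qed

text \<open>The face lattice is isomorphic to the family of vertex sets of faces, so a vertex
  bijection preserving that family induces an isomorphism.\<close>

lemma comb_equiv_vertex_bij:
  assumes P: "polytope P" and Q: "polytope Q"
    and g: "bij_betw g (vertices P) (vertices Q)"
    and gf: "\<And>A. A \<subseteq> vertices P \<Longrightarrow> A \<in> vertices ` faces P \<longleftrightarrow> g ` A \<in> vertices ` faces Q"
  shows "P \<simeq>\<^sub>c Q"
proof -
  have inj: "inj_on g (vertices P)" and im: "g ` vertices P = vertices Q"
    using g by (auto simp: bij_betw_def)
  have subP: "vertices F \<subseteq> vertices P" if "F \<in> faces P" for F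
    using that by (auto simp: vertices_face)
  have "\<exists>G\<in>faces Q. vertices G = g ` vertices F" if "F \<in> faces P" for F
    using gf[OF subP[OF that]] that by blast
  then obtain \<phi> where \<phi>: "\<And>F. F \<in> faces P \<Longrightarrow> \<phi> F \<in> faces Q"
    "\<And>F. F \<in> faces P \<Longrightarrow> vertices (\<phi> F) = g ` vertices F" by metis
  have ord: "F \<subseteq> G \<longleftrightarrow> \<phi> F \<subseteq> \<phi> G" if FG: "F \<in> faces P" "G \<in> faces P" for F G
  proof -
    have "\<phi> F \<subseteq> \<phi> G \<longleftrightarrow> g ` vertices F \<subseteq> g ` vertices G"
      using vertices_subset_iff[OF Q] \<phi> FG by metis
    also have "\<dots> \<longleftrightarrow> vertices F \<subseteq> vertices G"
      using inj subP FG by (meson inj_on_image_subset_iff)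
    finally show ?thesis using vertices_subset_iff[OF P] FG by blast
  qed
  have "inj_on \<phi> (faces P)"
    using ord by (intro inj_onI) (metis subset_antisym order_refl)
  moreover have "G \<in> \<phi> ` faces P" if G: "G \<in> faces Q" for G
  proof -
    have "vertices G \<subseteq> g ` vertices P" using G by (simp add: im vertices_face)
    then obtain A where A: "A \<subseteq> vertices P" "vertices G = g ` A"
      by (meson subset_imageE)
    then have "A \<in> vertices ` faces P" using gf[OF A(1)] G by (metis imageI)
    then obtain F where F: "F \<in> faces P" "A = vertices F" by blast
    then have "vertices (\<phi> F) = vertices G" using \<phi> A by simp
    then have "\<phi> F = G"
      using vertices_subset_iff[OF Q] \<phi>(1)[OF F(1)] G by (metis subset_antisym order_refl)
    then show ?thesis using F by blast
  qed
  ultimately have "bij_betw \<phi> (faces P) (faces Q)"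
    using \<phi>(1) by (auto simp: bij_betw_def)
  then show ?thesis unfolding comb_equiv_def using ord by blast
qed

lemma aff_dim_face_cases:
  assumes P: "polytope P" "aff_dim P \<le> 2" and F: "F \<in> faces P"
  shows "F = {} \<or> (\<exists>v\<in>vertices P. F = {v}) \<or> F \<in> edges P \<or> F = P"
proof (cases "F = P")
  case False
  have Ff: "F face_of P" using F by (simp add: faces_def)
  then have "aff_dim F < aff_dim P"
    using face_of_aff_dim_lt polytope_imp_convex P(1) False by blast
  then have "aff_dim F = -1 \<or> aff_dim F = 0 \<or> aff_dim F = 1"
    using P(2) aff_dim_geq[of F] by linarith
  then show ?thesis
    using Ff F by (auto simp: aff_dim_empty[symmetric] aff_dim_eq_0 edges_def vertices_def face_of_singleton)
qed simp

text \<open>In dimension at most two only the edges are not dictated by the vertex set, so matching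
  faces reduces to matching edges.\<close>

lemma vertices_image_faces:
  assumes P: "polytope P" "aff_dim P \<le> 2"
  shows "vertices ` faces P
    = {{}, vertices P} \<union> (\<lambda>v. {v}) ` vertices P \<union> vertices ` edges P"
proof -
  have "faces P = {{}, P} \<union> (\<lambda>v. {v}) ` vertices P \<union> edges P"
    using aff_dim_face_cases[OF P] polytope_imp_convex[OF P(1)]
    by (auto simp: faces_def edges_def vertices_def face_of_singleton face_of_refl)
  moreover have "vertices {v} = {v}" "vertices ({} :: 'a set) = {}" for v :: 'a
    by (auto simp: vertices_def)
  ultimately show ?thesis by (simp add: image_Un image_image)
qed

text \<open>Vertices with equal labels correspond, and the same pairs of labels mark the edges on
  both sides.\<close>

lemma comb_equiv_of_cycle_labelling:
  assumes P: "polytope P" "aff_dim P \<le> 2" and Q: "polytope Q" "aff_dim Q \<le> 2"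
    and f: "bij_betw f {..<n} (vertices P)" "vertices ` edges P = (`) f ` cycle_edges n"
    and g: "bij_betw g {..<n} (vertices Q)" "vertices ` edges Q = (`) g ` cycle_edges n"
  shows "P \<simeq>\<^sub>c Q"
proof (rule comb_equiv_vertex_bij[OF P(1) Q(1)])
  let ?h = "g \<circ> inv_into {..<n} f"
  show h: "bij_betw ?h (vertices P) (vertices Q)"
    using bij_betw_trans[OF bij_betw_inv_into[OF f(1)] g(1)] .
  have c: "e \<subseteq> {..<n}" if "e \<in> cycle_edges n" for e
    using that by (auto simp: cycle_edges_def split: if_splits)
  have hf: "?h ` f ` e = g ` e" if "e \<subseteq> {..<n}" for e
  proof -
    have "inv_into {..<n} f ` f ` e = e"
      using f(1) that by (auto simp: bij_betw_def inv_into_image_cancel)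
    then show ?thesis by (simp only: image_comp[symmetric])
  qed
  have "(`) ?h ` ((`) f ` cycle_edges n) = (\<lambda>e. ?h ` (f ` e)) ` cycle_edges n"
    by (rule image_image)
  also have "\<dots> = (`) g ` cycle_edges n" by (intro image_cong refl hf c)
  finally have E: "vertices ` edges Q = (`) ?h ` (vertices ` edges P)"
    by (simp only: f(2) g(2))
  have V: "vertices Q = ?h ` vertices P" and inj: "inj_on ?h (vertices P)"
    using h by (auto simp: bij_betw_def)
  have im: "vertices ` faces Q = (`) ?h ` (vertices ` faces P)"
    unfolding vertices_image_faces[OF P] vertices_image_faces[OF Q] image_Un E V
    by (simp add: image_image)
  have injP: "inj_on ((`) ?h) (Pow (vertices P))"
    using inj by (rule inj_on_image_Pow)
  have sub: "vertices ` faces P \<subseteq> Pow (vertices P)"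
    by (auto simp: vertices_face)
  fix A assume "A \<subseteq> vertices P"
  then show "A \<in> vertices ` faces P \<longleftrightarrow> ?h ` A \<in> vertices ` faces Q"
    unfolding im using inj_on_image_mem_iff[OF injP _ sub] by (simp only: Pow_iff)
qed

section \<open>Edges of polygons\<close>

lemma edge_is_segment:
  assumes "polytope P" "e \<in> edges P"
  shows "\<exists>u v. u \<noteq> v \<and> e = closed_segment u v \<and> vertices e = {u, v}"
proof -
  have e: "polytope e" "aff_dim e = 1"
    using assms polytope_face by (auto simp: edges_def)
  then have "e \<noteq> {}" "collinear e" by (auto simp: collinear_aff_dim)
  then obtain u v where uv: "e = closed_segment u v"
    using compact_convex_collinear_segment[of e] polytope_imp_compact[OF e(1)]
      polytope_imp_convex[OF e(1)] by metis
  have "u \<noteq> v" using uv e by auto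
  moreover have "vertices e = {u, v}"
    unfolding uv vertices_def by (auto simp: extreme_point_of_segment)
  ultimately show ?thesis using uv by (intro exI conjI)
qed

text \<open>A vertex is the intersection of the facets containing it, which are edges in dimension
  two. The intersection of no edges is the whole space and that of a single edge is a segment,
  neither of which is a point.\<close>

lemma edges_through_vertex_ge_2:
  assumes P: "polytope P" "aff_dim P = 2" and v: "v \<in> vertices P"
  shows "2 \<le> card {e \<in> edges P. v \<in> e}"
proof -
  let ?E = "{e \<in> edges P. v \<in> e}"
  have "finite ?E" using finite_polytope_faces[OF P(1)] by (simp add: edges_def faces_def)
  have "{v} face_of P" using v by (simp add: vertices_def face_of_singleton)
  moreover have "{v} \<noteq> P" using P(2) by auto
  ultimately have "{v} = \<Inter>{F. F facet_of P \<and> {v} \<subseteq> F}"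
    using face_of_polyhedron[OF polytope_imp_polyhedron[OF P(1)], of "{v}"] by blast
  moreover have "{F. F facet_of P \<and> {v} \<subseteq> F} = ?E"
    using P(2) by (auto simp: facet_of_def edges_def faces_def)
  ultimately have I: "{v} = \<Inter>?E" by (simp only:)
  show ?thesis
  proof (rule ccontr)
    assume "\<not> ?thesis"
    then have "card ?E = 0 \<or> card ?E = 1" by linarith
    then show False
    proof
      assume "card ?E = 0"
      then have "?E = {}" using \<open>finite ?E\<close> by simp
      then have "{v} = UNIV" using I by (metis Inf_empty)
      then have "P \<subseteq> {v}" by simp
      then show False using P(2) aff_dim_subset[of P "{v}"] by simp
    next
      assume "card ?E = 1"
      then obtain e where e: "?E = {e}" by (auto simp: card_1_singleton_iff)
      then have "{v} = e" using I by simp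
      moreover have "e \<in> edges P" using e by blast
      ultimately show False by (auto simp: edges_def)
    qed
  qed
qed

text \<open>A line close to the vertex \<open>v\<close> meets \<open>P\<close> in a segment, and each edge through \<open>v\<close> in an
  end point of that segment.\<close>

lemma edges_through_vertex_le_2:
  assumes P: "polytope P" "aff_dim P = 2" and v: "v \<in> vertices P"
  shows "card {e \<in> edges P. v \<in> e} \<le> 2"
proof -
  let ?E = "{e \<in> edges P. v \<in> e}"
  have cP: "convex P" "compact P" using P polytope_imp_convex polytope_imp_compact by auto
  \<comment> \<open>Since \<open>v\<close> is extreme, the hull of the other vertices misses it, and
    a hyperplane passes strictly between them; its trace on the plane of \<open>P\<close> is at most
    a line.\<close>
  let ?W = "convex hull (vertices P - {v})"
  have "convex (P - {v})" using v cP by (simp add: vertices_def extreme_point_of_stillconvex)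
  then have "?W \<subseteq> P - {v}"
    using vertices_subset by (intro hull_minimal) blast+
  moreover have "closed ?W"
    using finite_vertices[OF P(1)] by (simp add: compact_imp_closed finite_imp_compact_convex_hull)
  ultimately obtain a b where ab: "a \<bullet> v < b" "\<forall>x\<in>?W. b < a \<bullet> x"
    using separating_hyperplane_closed_point[of ?W v] convex_convex_hull by blast
  let ?L = "{x. a \<bullet> x = b}"
  have conv: "convex (P \<inter> ?L)" "compact (P \<inter> ?L)"
    using cP by (auto simp: convex_Int convex_hyperplane compact_Int_closed closed_hyperplane)
  have "\<exists>q. q extreme_point_of (P \<inter> ?L) \<and> q \<in> e" if e: "e \<in> ?E" for e
  proof -
    obtain s t where st: "s \<noteq> t" "e = closed_segment s t" "vertices e = {s, t}"
      using edge_is_segment[OF P(1)] e by blast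
    have "v \<in> vertices e" using e v by (auto simp: edges_def vertices_face)
    then obtain u where u: "e = closed_segment v u" "u \<noteq> v" "u \<in> vertices e"
      using st closed_segment_commute by (metis insertE insertI1 insertI2 singletonD)
    \<comment> \<open>The far end of the edge lies beyond the hyperplane, so the edge crosses
      it.\<close>
    then have "u \<in> ?W" using e by (intro hull_inc) (auto simp: edges_def vertices_face)
    then have bu: "b < a \<bullet> u" using ab by blast
    have ce: "convex e" "compact e" by (simp_all add: st)
    obtain z where "z \<in> e" "a \<bullet> z = b"
      using connected_ivt_hyperplane[of e v u a b] ab bu u by (auto simp: convex_connected)
    then have "e \<inter> ?L \<noteq> {}" by blast
    moreover have "compact (e \<inter> ?L)" "convex (e \<inter> ?L)"
      using ce by (auto simp: convex_Int convex_hyperplane compact_Int_closed closed_hyperplane)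
    ultimately obtain q where q: "q extreme_point_of (e \<inter> ?L)"
      using extreme_point_exists_convex by blast
    \<comment> \<open>Cutting by a convex set keeps faces faces, so an extreme point of the cut edge
      is one of the cut polygon.\<close>
    have "(e \<inter> ?L) face_of (P \<inter> ?L)"
      using e by (intro face_of_slice convex_hyperplane) (auto simp: edges_def faces_def)
    then show ?thesis using q extreme_point_of_face by blast
  qed
  then obtain q where q: "\<And>e. e \<in> ?E \<Longrightarrow> q e extreme_point_of (P \<inter> ?L)" "\<And>e. e \<in> ?E \<Longrightarrow> q e \<in> e"
    by metis
  have qL: "q e \<noteq> v" if "e \<in> ?E" for e
    using q(1)[OF that] ab by (auto simp: extreme_point_of_def)
  have "inj_on q ?E"
  proof (rule inj_onI, rule ccontr)
    fix e e' assume e: "e \<in> ?E" "e' \<in> ?E" "q e = q e'" "e \<noteq> e'"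
    have f: "e face_of P" "e' face_of P" "aff_dim e = 1" "aff_dim e' = 1"
      using e by (auto simp: edges_def faces_def)
    \<comment> \<open>Distinct edges meet in a face of dimension below 1, yet both would contain
      \<open>v\<close> and the common point on \<open>?L\<close>.\<close>
    have "e \<inter> e' \<noteq> e \<or> e \<inter> e' \<noteq> e'" using e(4) by blast
    moreover have "(e \<inter> e') face_of e" "(e \<inter> e') face_of e'"
      using f by (auto intro: face_of_subset[OF face_of_Int] dest: face_of_imp_subset)
    ultimately have "aff_dim (e \<inter> e') < 1"
      using f face_of_aff_dim_lt face_of_imp_convex by metis
    moreover have "{v, q e} \<subseteq> e \<inter> e'" using e q(2) by force
    then have "aff_dim {v, q e} \<le> aff_dim (e \<inter> e')" by (rule aff_dim_subset)
    moreover have "aff_dim {v, q e} = 1" using qL[OF e(1)] by (simp add: aff_dim_2)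
    ultimately show False by simp
  qed
  moreover have "\<exists>s t. {x. x extreme_point_of (P \<inter> ?L)} \<subseteq> {s, t}"
  proof (cases "P \<inter> ?L = {}")
    case False
    \<comment> \<open>As \<open>v\<close> is off \<open>?L\<close>, the cut has dimension at most 1,
      so it is a segment and has at most two extreme points.\<close>
    have "v \<in> affine hull P" using hull_inc[of v P affine] v vertices_subset[of P] by auto
    then have "\<not> affine hull P \<subseteq> ?L" using ab by auto
    then have "aff_dim (affine hull P \<inter> ?L) \<le> 1"
      using P(2) by (simp add: aff_dim_affine_Int_hyperplane)
    moreover have "aff_dim (P \<inter> ?L) \<le> aff_dim (affine hull P \<inter> ?L)"
      by (intro aff_dim_subset) (auto intro: hull_inc)
    ultimately have "collinear (P \<inter> ?L)" by (simp add: collinear_aff_dim)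
    then obtain s t where "P \<inter> ?L = closed_segment s t"
      using compact_convex_collinear_segment[OF False conv(2,1)] by metis
    then show ?thesis by (intro exI[of _ s] exI[of _ t]) (auto simp: extreme_point_of_segment)
  next
    case True
    show ?thesis unfolding True by simp
  qed
  then obtain s t where "{x. x extreme_point_of (P \<inter> ?L)} \<subseteq> {s, t}" by (elim exE)
  then have "q e \<in> {s, t}" if "e \<in> ?E" for e
    using q(1)[OF that] by (meson CollectI subsetD)
  then have "q ` ?E \<subseteq> {s, t}" by (rule image_subsetI)
  ultimately have "card ?E \<le> card {s, t}" by (metis card_inj_on_le finite.emptyI finite_insert)
  also have "\<dots> \<le> 2" by (simp add: card_insert_if)
  finally show ?thesis .
qed

text \<open>Edges are maximal by dimension, and each smaller face lies in one because every vertex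
  is on an edge.\<close>

lemma coatoms_polygon:
  assumes P: "polytope P" "aff_dim P = 2"
  shows "coatoms P = edges P"
proof
  have cP: "convex P" using P polytope_imp_convex by blast
  have ne: "vertices P \<noteq> {}"
    using P polytope_eq_hull_vertices[OF P(1)] by auto
  have ex: "\<exists>e\<in>edges P. v \<in> e" if "v \<in> vertices P" for v
  proof -
    have "{e \<in> edges P. v \<in> e} \<noteq> {}"
      using edges_through_vertex_ge_2[OF P that] by (metis card.empty not_numeral_le_zero)
    then show ?thesis by blast
  qed
  show "edges P \<subseteq> coatoms P"
  proof
    fix e assume e: "e \<in> edges P"
    have "G = e \<or> G = P" if G: "G face_of P" "e \<subseteq> G" for G
    proof (rule ccontr)
      assume n: "\<not> ?thesis"
      then have "aff_dim G < 2" using face_of_aff_dim_lt[OF cP G(1)] P(2) by simp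
      moreover have "e face_of P" using e by (simp add: edges_def faces_def)
      then have "e face_of G" using face_of_subset G(2) face_of_imp_subset[OF G(1)] by blast
      then have "aff_dim e < aff_dim G"
        using face_of_aff_dim_lt[OF face_of_imp_convex[OF G(1)]] n by blast
      ultimately show False using e by (simp add: edges_def)
    qed
    then show "e \<in> coatoms P" using e P(2) by (auto simp: coatoms_def edges_def faces_def)
  qed
  show "coatoms P \<subseteq> edges P"
  proof
    fix F assume F: "F \<in> coatoms P"
    then have max: "\<And>e. e \<in> edges P \<Longrightarrow> F \<subseteq> e \<Longrightarrow> F = e"
      using P(2) by (force simp: coatoms_def edges_def)
    have "F = {} \<or> (\<exists>v\<in>vertices P. F = {v}) \<or> F \<in> edges P"
      using aff_dim_face_cases[of P F] P F by (auto simp: coatoms_def)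
    then show "F \<in> edges P"
      using ne ex max by (metis empty_subsetI ex_in_conv insert_subset)
  qed
qed

text \<open>Each vertex lies on two edges and each edge has two vertices, so double counting gives
  as many vertices as edges, and the edges form a two-regular graph.\<close>

lemma polygon_cycle_labelling:
  assumes P: "polytope P" "aff_dim P = 2" and n: "card (coatoms P) \<le> 5"
  shows "\<exists>f. bij_betw f {..<card (coatoms P)} (vertices P) \<and>
    vertices ` edges P = (`) f ` cycle_edges (card (coatoms P))"
proof -
  have finV: "finite (vertices P)" using finite_vertices P by blast
  have finE: "finite (edges P)"
    using finite_polytope_faces[OF P(1)] by (simp add: edges_def faces_def)
  have injE: "inj_on vertices (edges P)"
    using vertices_subset_iff[OF P(1)] by (intro inj_onI) (auto simp: edges_def)
  have two: "card {e \<in> edges P. v \<in> e} = 2" if "v \<in> vertices P" for v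
    using edges_through_vertex_ge_2[OF P that] edges_through_vertex_le_2[OF P that] by simp
  have two': "card (vertices e) = 2" "vertices e \<subseteq> vertices P" if "e \<in> edges P" for e
    using edge_is_segment[OF P(1) that] that by (auto simp: edges_def vertices_face)
  have deg: "card {e \<in> vertices ` edges P. v \<in> e} = 2" if v: "v \<in> vertices P" for v
  proof -
    have "{e \<in> vertices ` edges P. v \<in> e} = vertices ` {e \<in> edges P. v \<in> e}"
      using v by (auto simp: edges_def vertices_face)
    moreover have "inj_on vertices {e \<in> edges P. v \<in> e}"
      using injE by (rule inj_on_subset) auto
    ultimately show ?thesis using two[OF v] by (simp add: card_image)
  qed
  have "(\<Sum>v\<in>vertices P. card {e \<in> edges P. v \<in> vertices e}) = 2 * card (edges P)"
  proof (rule sum_multicount[OF finV finE], rule ballI)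
    fix e assume e: "e \<in> edges P"
    then have "{v \<in> vertices P. v \<in> vertices e} = vertices e" using two' by blast
    then show "card {v \<in> vertices P. v \<in> vertices e} = 2" using two'(1)[OF e] by simp
  qed
  moreover have "{e \<in> edges P. v \<in> vertices e} = {e \<in> edges P. v \<in> e}" if "v \<in> vertices P" for v
    using that by (auto simp: edges_def vertices_face)
  ultimately have "card (vertices P) = card (edges P)" by (simp add: two)
  then have card: "card (coatoms P) = card (vertices P)" by (simp add: coatoms_polygon[OF P])
  have "vertices P \<noteq> {}" using P polytope_eq_hull_vertices[OF P(1)] by auto
  then show ?thesis
    unfolding card using n two' finV deg
    by (intro two_regular_cycle) (auto simp: card)
qed

text \<open>The empty set, a point and a segment have counts 0, 1 and 2, for which
  \<open>cycle_edges\<close> provides no edge, no edge and one edge.\<close>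

lemma low_dim_cycle_labelling:
  assumes P: "polytope P" "aff_dim P \<le> 1"
  shows "\<exists>f. bij_betw f {..<card (coatoms P)} (vertices P) \<and>
    vertices ` edges P = (`) f ` cycle_edges (card (coatoms P))"
proof -
  have cP: "convex P" using P polytope_imp_convex by blast
  have edP: "edges P = (if aff_dim P = 1 then {P} else {})"
    using P(2) face_of_aff_dim_lt[OF cP] cP by (force simp: edges_def faces_def face_of_refl)
  have fP: "faces P = insert {} (insert P ((\<lambda>v. {v}) ` vertices P))"
    using aff_dim_face_cases[OF P(1)] P(2) cP edP
    by (auto simp: faces_def vertices_def face_of_singleton face_of_refl split: if_splits)
  consider "P = {}" | v where "P = {v}" | u v where "u \<noteq> v" "P = closed_segment u v"
  proof -
    have "collinear P" using P(2) by (simp add: collinear_aff_dim)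
    then have "P \<noteq> {} \<Longrightarrow> \<exists>u v. P = closed_segment u v"
      using compact_convex_collinear_segment[of P] cP polytope_imp_compact[OF P(1)] by metis
    then show ?thesis using that by (metis closed_segment_idem)
  qed
  then show ?thesis
  proof cases
    case 1
    have "coatoms P = {}" "vertices P = {}" by (auto simp: 1 coatoms_def faces_def vertices_def)
    moreover have "edges P = {}" unfolding edP by (simp add: 1)
    ultimately show ?thesis by (simp add: cycle_edges_def bij_betw_def)
  next
    case (2 v)
    have "vertices P = {v}" by (auto simp: 2 vertices_def)
    moreover have "coatoms P = {{}}" unfolding coatoms_def fP calculation by (auto simp: 2)
    moreover have "edges P = {}" unfolding edP by (simp add: 2)
    ultimately show ?thesis
      by (auto simp: cycle_edges_def bij_betw_def lessThan_Suc intro!: exI[of _ "\<lambda>_. v"])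
  next
    case (3 u v)
    have V: "vertices P = {u, v}" by (auto simp: 3 vertices_def extreme_point_of_segment)
    have "P \<noteq> {u}" "P \<noteq> {v}" "u \<in> P" "v \<in> P" using 3 by auto
    then have c: "coatoms P = {{u}, {v}}" unfolding coatoms_def fP V using 3(1) by auto
    then have c2: "card (coatoms P) = 2" using 3 by simp
    have "aff_dim P = 1" using 3 by (simp add: segment_convex_hull aff_dim_convex_hull aff_dim_2)
    then have e: "edges P = {P}" unfolding edP by simp
    define f where "f = (\<lambda>i. if i = (0::nat) then u else v)"
    have "bij_betw f {..<2} (vertices P)"
      using 3(1) V by (auto simp: bij_betw_def inj_on_def f_def numeral_2_eq_2 lessThan_Suc)
    moreover have "vertices ` edges P = (`) f ` cycle_edges 2"
      using V by (auto simp: e cycle_edges_def f_def numeral_2_eq_2 lessThan_Suc)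
    ultimately show ?thesis using c2 by auto
  qed
qed

lemma cycle_labelling:
  assumes "polytope P" "aff_dim P \<le> 2" "card (coatoms P) \<le> 5"
  shows "\<exists>f. bij_betw f {..<card (coatoms P)} (vertices P) \<and>
    vertices ` edges P = (`) f ` cycle_edges (card (coatoms P))"
proof (cases "aff_dim P = 2")
  case True
  then show ?thesis using polygon_cycle_labelling[of P] assms by simp
next
  case False
  then have "aff_dim P \<le> 1" using assms by simp
  then show ?thesis using low_dim_cycle_labelling[of P] assms by simp
qed

text \<open>A cyclic labelling describes the face lattice in terms of the coatom count alone; the
  bound 5 is that of \<open>two_regular_cycle\<close>.\<close>

theorem comb_equiv_iff_card_coatoms:
  assumes P: "polytope P" "aff_dim P \<le> 2" "card (coatoms P) \<le> 5"
    and Q: "polytope Q" "aff_dim Q \<le> 2" "card (coatoms Q) \<le> 5"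
  shows "P \<simeq>\<^sub>c Q \<longleftrightarrow> card (coatoms P) = card (coatoms Q)"
proof
  assume "P \<simeq>\<^sub>c Q"
  then show "card (coatoms P) = card (coatoms Q)"
    using P Q by (simp add: polytope_imp_convex card_coatoms_comb_equiv)
next
  assume "card (coatoms P) = card (coatoms Q)"
  then show "P \<simeq>\<^sub>c Q"
    using cycle_labelling[OF P] cycle_labelling[OF Q] comb_equiv_of_cycle_labelling P Q by metis
qed

section \<open>Square pyramid and triangular prism\<close>

text \<open>Every nonempty face of a polytope contains a vertex, so the vertices are the atoms of
  the face lattice and are visible to the order alone.\<close>

lemma faces_minimal_iff_vertex:
  assumes P: "polytope P" and F: "F \<in> faces P"
  shows "F \<noteq> {} \<and> (\<forall>G\<in>faces P. G \<subseteq> F \<longrightarrow> G = {} \<or> G = F) \<longleftrightarrow> (\<exists>v\<in>vertices P. F = {v})"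
proof
  assume *: "F \<noteq> {} \<and> (\<forall>G\<in>faces P. G \<subseteq> F \<longrightarrow> G = {} \<or> G = F)"
  then have "vertices F \<noteq> {}"
    using polytope_eq_hull_vertices[OF polytope_face[OF P F]] by auto
  then obtain v where v: "v \<in> vertices P" "v \<in> F" using F by (auto simp: vertices_face)
  then have "{v} \<in> faces P" by (simp add: faces_def vertices_def face_of_singleton)
  then show "\<exists>v\<in>vertices P. F = {v}" using * v by (metis empty_subsetI insert_not_empty insert_subset)
qed auto

lemma card_vertices_comb_equiv:
  assumes "P \<simeq>\<^sub>c Q" and P: "polytope P" and Q: "polytope Q"
  shows "card (vertices P) = card (vertices Q)"
proof -
  obtain \<phi> where b: "bij_betw \<phi> (faces P) (faces Q)"
    and o: "\<And>F G. F \<in> faces P \<Longrightarrow> G \<in> faces P \<Longrightarrow> F \<subseteq> G \<longleftrightarrow> \<phi> F \<subseteq> \<phi> G"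
    using assms(1) comb_equivE by metis
  have im: "faces Q = \<phi> ` faces P" using b by (simp add: bij_betw_def)
  have e: "{} \<in> faces P" "{} \<in> faces Q" by (auto simp: faces_def)
  have inj: "\<phi> F = \<phi> G \<longleftrightarrow> F = G" if "F \<in> faces P" "G \<in> faces P" for F G
    using b that by (auto simp: bij_betw_def inj_on_def)
  obtain F where "F \<in> faces P" "\<phi> F = {}" using e(2) im by auto
  then have "\<phi> {} = {}" using o[OF e(1), of F] by auto
  then have empty: "\<phi> F = {} \<longleftrightarrow> F = {}" if "F \<in> faces P" for F
    using inj[OF that e(1)] by simp
  have iff: "(\<exists>w\<in>vertices Q. \<phi> F = {w}) \<longleftrightarrow> (\<exists>v\<in>vertices P. F = {v})" if F: "F \<in> faces P" for F
  proof -
    have "\<phi> F \<in> faces Q" using F im by simp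
    then show ?thesis
      unfolding faces_minimal_iff_vertex[OF P F, symmetric] 
        faces_minimal_iff_vertex[OF Q \<open>\<phi> F \<in> faces Q\<close>, symmetric]
      by (simp add: im empty F inj o[OF _ F, symmetric] cong: ball_cong)
  qed
  have s: "(\<lambda>v. {v}) ` vertices R = {F \<in> faces R. \<exists>v\<in>vertices R. F = {v}}" for R :: "'c::euclidean_space set"
    by (auto simp: faces_def vertices_def face_of_singleton)
  have "(\<lambda>v. {v}) ` vertices Q = \<phi> ` ((\<lambda>v. {v}) ` vertices P)"
  proof -
    have "{G \<in> \<phi> ` faces P. R G} = \<phi> ` {F \<in> faces P. R (\<phi> F)}" for R by auto
    moreover have "{F \<in> faces P. \<exists>w\<in>vertices Q. \<phi> F = {w}} = {F \<in> faces P. \<exists>v\<in>vertices P. F = {v}}"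
      by (intro Collect_cong conj_cong refl iff)
    ultimately show ?thesis unfolding s im by simp
  qed
  moreover have "inj_on \<phi> ((\<lambda>v. {v}) ` vertices P)"
    unfolding s using inj by (auto simp: inj_on_def)
  ultimately have "card ((\<lambda>v. {v}) ` vertices Q) = card ((\<lambda>v. {v}) ` vertices P)"
    by (simp only: card_image)
  then show ?thesis by (simp add: card_image)
qed

lemma f_vector_0:
  "f_vector P 0 = card (vertices P)"
proof -
  have "{F \<in> faces P. aff_dim F = 0} = (\<lambda>v. {v}) ` vertices P"
    by (auto simp: aff_dim_eq_0 faces_def vertices_def face_of_singleton)
  then show ?thesis by (simp add: f_vector_def card_image)
qed

text \<open>\<open>x\<close> is the midpoint of \<open>x - d\<close> and
  \<open>x + d\<close>.\<close>

lemma extreme_point_of_perturb: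
  assumes "x extreme_point_of S" "x + d \<in> S" "x - d \<in> S"
  shows "d = 0"
proof (rule ccontr)
  assume "d \<noteq> 0"
  have "x = (1 - 1/2) *\<^sub>R (x - d) + (1/2) *\<^sub>R (x + d)"
    by (simp add: algebra_simps flip: scaleR_add_left)
  moreover have "x - d \<noteq> x + d"
  proof
    assume "x - d = x + d"
    then have "2 *\<^sub>R d = 0" by (simp add: scaleR_2 algebra_simps)
    then show False using \<open>d \<noteq> 0\<close> by simp
  qed
  ultimately have "x \<in> open_segment (x - d) (x + d)"
    unfolding in_segment by (intro conjI exI[of _ "1/2"]) auto
  then show False using assms by (auto simp: extreme_point_of_def)
qed

section \<open>Setwise slice equivalence by counting\<close>

text \<open>Slices have dimension at most two, so their types are recorded by their coatom counts,
  and for both polytopes these are exactly 0 to 5.\<close>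

lemma setwise_slice_equiv_of_card_coatoms:
  fixes P Q :: "(real ^ 3) set"
  assumes P: "polytope P" "\<And>H. H \<in> affine_hyperplanes \<Longrightarrow> card (coatoms (P \<inter> H)) \<le> 5"
      "\<And>k. k \<le> 5 \<Longrightarrow> \<exists>H\<in>affine_hyperplanes. card (coatoms (P \<inter> H)) = k"
    and Q: "polytope Q" "\<And>H. H \<in> affine_hyperplanes \<Longrightarrow> card (coatoms (Q \<inter> H)) \<le> 5"
      "\<And>k. k \<le> 5 \<Longrightarrow> \<exists>H\<in>affine_hyperplanes. card (coatoms (Q \<inter> H)) = k"
  shows "setwise_slice_equiv P Q"
proof -
  have slice: "polytope (R \<inter> H)" "aff_dim (R \<inter> H) \<le> 2"
    if RH: "polytope R" "H \<in> affine_hyperplanes" for R H :: "(real ^ 3) set"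
  proof -
    show "polytope (R \<inter> H)"
      using RH by (intro polytope_Int_polyhedron affine_imp_polyhedron affine_affine_hyperplane)
    obtain a b where "a \<noteq> 0" "H = {x. a \<bullet> x = b}"
      using RH(2) unfolding affine_hyperplanes_def by blast
    then have "aff_dim H = 2" by (simp add: aff_dim_hyperplane)
    then show "aff_dim (R \<inter> H) \<le> 2" using aff_dim_subset[of "R \<inter> H" H] by simp
  qed
  have sub: "{comb_type (R \<inter> H) |H. H \<in> affine_hyperplanes} \<subseteq> {comb_type (S \<inter> H) |H. H \<in> affine_hyperplanes}"
    if R: "polytope R" "\<And>H. H \<in> affine_hyperplanes \<Longrightarrow> card (coatoms (R \<inter> H)) \<le> 5"
      and S: "polytope S" "\<And>k. k \<le> 5 \<Longrightarrow> \<exists>H\<in>affine_hyperplanes. card (coatoms (S \<inter> H)) = k"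
    for R S :: "(real ^ 3) set"
  proof clarify
    fix H :: "(real ^ 3) set" assume H: "H \<in> affine_hyperplanes"
    obtain H' where H': "H' \<in> affine_hyperplanes" "card (coatoms (S \<inter> H')) = card (coatoms (R \<inter> H))"
      using S(2)[OF R(2)[OF H]] by blast
    have "R \<inter> H \<simeq>\<^sub>c S \<inter> H'"
      using H' R(2)[OF H] slice[OF R(1) H] slice[OF S(1) H'(1)]
      by (subst comb_equiv_iff_card_coatoms) simp_all
    then have "comb_type (R \<inter> H) = comb_type (S \<inter> H')"
      using comb_type_eq_iff slice[OF R(1) H] by blast
    then show "\<exists>H'. comb_type (R \<inter> H) = comb_type (S \<inter> H') \<and> H' \<in> affine_hyperplanes"
      using H'(1) by blast
  qed
  show ?thesis unfolding setwise_slice_equiv_def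
    by (intro subset_antisym sub) (use P Q in blast)+
qed

lemma plane_in_hyperplanes:
  assumes "vector [p, q, r] \<noteq> (0 :: real ^ 3)"
  shows "{x :: real ^ 3. p * x $ 1 + q * x $ 2 + r * x $ 3 = c} \<in> affine_hyperplanes"
  unfolding affine_hyperplanes_def using assms
  by (intro CollectI exI[of _ "vector [p, q, r]"] exI[of _ c]) (simp add: inner_vec_def sum_3)

lemma ball_lessThan_5: "(\<forall>i\<in>{..<5::nat}. R i) \<longleftrightarrow> R 0 \<and> R 1 \<and> R 2 \<and> R 3 \<and> R 4"
proof -
  have "{..<5::nat} = {0, 1, 2, 3, 4}" by auto
  then show ?thesis by simp
qed

section \<open>The pyramid and the prism in coordinates\<close>

text \<open>Apex (0, 0, 1) over the unit square in the plane of the first two coordinates.\<close>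

definition pyramid_normal :: "nat \<Rightarrow> real ^ 3" where
  "pyramid_normal = (!) [vector [-1, 0, 0], vector [0, -1, 0], vector [0, 0, -1],
    vector [1, 0, 1], vector [0, 1, 1]]"

text \<open>The triangle (0, 0), (1, 0), (0, 1) times the unit interval, ordered so that
  \<open>offset\<close> serves both polytopes.\<close>

definition prism_normal :: "nat \<Rightarrow> real ^ 3" where
  "prism_normal = (!) [vector [-1, 0, 0], vector [0, -1, 0], vector [0, 0, -1],
    vector [0, 0, 1], vector [1, 1, 0]]"

definition offset :: "nat \<Rightarrow> real" where
  "offset = (!) [0, 0, 0, 1, 1]"

definition pyramid :: "(real ^ 3) set" where
  "pyramid = hpoly UNIV {..<5} pyramid_normal offset"

definition prism :: "(real ^ 3) set" where
  "prism = hpoly UNIV {..<5} prism_normal offset"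

lemma inner_vector_3: "vector [p, q, r] \<bullet> (x :: real ^ 3) = p * x $ 1 + q * x $ 2 + r * x $ 3"
  by (simp add: inner_vec_def sum_3)

lemma mem_pyramid: "x \<in> pyramid \<longleftrightarrow>
    0 \<le> x $ 1 \<and> 0 \<le> x $ 2 \<and> 0 \<le> x $ 3 \<and> x $ 1 + x $ 3 \<le> 1 \<and> x $ 2 + x $ 3 \<le> 1"
  by (simp add: pyramid_def hpoly_def ball_lessThan_5 pyramid_normal_def offset_def inner_vector_3)

lemma mem_prism: "x \<in> prism \<longleftrightarrow>
    0 \<le> x $ 1 \<and> 0 \<le> x $ 2 \<and> 0 \<le> x $ 3 \<and> x $ 3 \<le> 1 \<and> x $ 1 + x $ 2 \<le> 1"
  by (simp add: prism_def hpoly_def ball_lessThan_5 prism_normal_def offset_def inner_vector_3)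

lemma bounded_of_unit_cube: 
  fixes S :: "(real ^ 3) set"
  assumes "\<And>x i. x \<in> S \<Longrightarrow> 0 \<le> x $ i \<and> x $ i \<le> 1"
  shows "bounded S"
proof -
  have "S \<subseteq> cbox 0 1" using assms by (auto simp: mem_box_cart)
  then show ?thesis using bounded_cbox bounded_subset by blast
qed

lemma full_dim_pyramid: "full_dim_polytope pyramid"
proof -
  have "bounded pyramid"
  proof (rule bounded_of_unit_cube)
    fix x and i :: 3 assume "x \<in> pyramid"
    then have "\<forall>i. 0 \<le> x $ i \<and> x $ i \<le> 1" by (auto simp: mem_pyramid forall_3)
    then show "0 \<le> x $ i \<and> x $ i \<le> 1" by blast
  qed
  moreover have "\<forall>i\<in>{..<5}. pyramid_normal i \<bullet> vector [1/4, 1/4, 1/4] < offset i"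
    by (simp add: ball_lessThan_5 pyramid_normal_def offset_def inner_vector_3)
  ultimately show ?thesis
    unfolding pyramid_def by (intro full_dim_polytope_hpoly) auto
qed

lemma full_dim_prism: "full_dim_polytope prism"
proof -
  have "bounded prism"
  proof (rule bounded_of_unit_cube)
    fix x and i :: 3 assume "x \<in> prism"
    then have "\<forall>i. 0 \<le> x $ i \<and> x $ i \<le> 1" by (auto simp: mem_prism forall_3)
    then show "0 \<le> x $ i \<and> x $ i \<le> 1" by blast
  qed
  moreover have "\<forall>i\<in>{..<5}. prism_normal i \<bullet> vector [1/4, 1/4, 1/4] < offset i"
    by (simp add: ball_lessThan_5 prism_normal_def offset_def inner_vector_3)
  ultimately show ?thesis
    unfolding prism_def by (intro full_dim_polytope_hpoly) auto
qed

text \<open>At a vertex no nonzero perturbation is possible in both directions, which pins down the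
  coordinates in turn. The upper bound is enough against the six vertices of the prism.\<close>

lemma card_vertices_pyramid: "card (vertices pyramid) \<le> 5"
proof -
  have "v \<in> {vector [0, 0, 1], vector [0, 0, 0], vector [1, 0, 0], vector [0, 1, 0], vector [1, 1, 0]}"
    if v: "v \<in> vertices pyramid" for v
  proof -
    define x y z where "x = v $ 1" and "y = v $ 2" and "z = v $ 3"
    have v_eq: "w = vector [w $ 1, w $ 2, w $ 3]" for w :: "real ^ 3"
      by (simp add: vec_eq_iff forall_3)
    have pert: "p = 0 \<and> q = 0 \<and> r = 0"
      if "v + vector [p, q, r] \<in> pyramid" "v - vector [p, q, r] \<in> pyramid" for p q r
    proof -
      have "vector [p, q, r] = (0 :: real ^ 3)"
        using extreme_point_of_perturb that v by (auto simp: vertices_def)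
      then show ?thesis by (simp add: vec_eq_iff forall_3)
    qed
    have pyr: "0 \<le> x" "0 \<le> y" "0 \<le> z" "x + z \<le> 1" "y + z \<le> 1"
      using v vertices_subset mem_pyramid unfolding x_def y_def z_def by blast+
    \<comment> \<open>Otherwise the first coordinate alone could move by the smaller of its two
      slacks.\<close>
    have x: "x = 0 \<or> x = 1 - z"
    proof (rule ccontr)
      assume "\<not> ?thesis"
      then have "0 < min x (1 - z - x)" using pyr by auto
      moreover have "min x (1 - z - x) = 0"
        using pyr by (intro pert[of _ 0 0, THEN conjunct1]) (auto simp: mem_pyramid x_def y_def z_def)
      ultimately show False by simp
    qed
    have y: "y = 0 \<or> y = 1 - z"
    proof (rule ccontr)
      assume "\<not> ?thesis"
      then have "0 < min y (1 - z - y)" using pyr by auto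
      moreover have "min y (1 - z - y) = 0"
        using pyr by (intro pert[of 0 _ 0, THEN conjunct2, THEN conjunct1])
          (auto simp: mem_pyramid x_def y_def z_def)
      ultimately show False by simp
    qed
    have z: "z = 0 \<or> z = 1"
    proof (rule ccontr)
      assume "\<not> ?thesis"
      then have e: "0 < min z (1 - z)" using pyr by auto
      let ?e = "min z (1 - z)"
      \<comment> \<open>Motion along a line through the apex: a coordinate equal to
        \<open>1 - z\<close> changes opposite to \<open>z\<close>, and a zero coordinate
        stays.\<close>
      have "?e = 0"
        using pyr x y
        by (intro pert[of "if x = 0 then 0 else - ?e" "if y = 0 then 0 else - ?e",
              THEN conjunct2, THEN conjunct2])
          (auto simp: mem_pyramid x_def y_def z_def)
      then show False using e by simp
    qed
    have "(x, y, z) \<in> {(0, 0, 1), (0, 0, 0), (1, 0, 0), (0, 1, 0), (1, 1, 0)}"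
      using x y z by auto
    then show ?thesis using v_eq[of v] unfolding x_def[symmetric] y_def[symmetric] z_def[symmetric]
      by auto
  qed
  \<comment> \<open>A list bounds the cardinality by its length, without a check of
    distinctness.\<close>
  then have "vertices pyramid \<subseteq> set [vector [0, 0, 1], vector [0, 0, 0], vector [1, 0, 0],
      vector [0, 1, 0], vector [1, 1, 0]]" by auto
  then have "card (vertices pyramid) \<le> card (set [vector [0, 0, 1] :: real ^ 3, vector [0, 0, 0],
      vector [1, 0, 0], vector [0, 1, 0], vector [1, 1, 0]])"
    by (intro card_mono) auto
  also have "\<dots> \<le> 5" by (rule order_trans[OF card_length]) simp
  finally show ?thesis .
qed

text \<open>Each listed point is the only one where the three facets meeting there are tight, hence
  a zero-dimensional face.\<close>

lemma card_vertices_prism: "6 \<le> card (vertices prism)"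
proof -
  have vert: "w \<in> vertices prism"
    if "J \<subseteq> {..<5}" "{x \<in> prism. \<forall>i\<in>J. prism_normal i \<bullet> x = offset i} = {w}" for w J
    using tight_face_of_hpoly[OF affine_UNIV finite_lessThan that(1), of prism_normal offset] that(2)
    by (simp add: prism_def vertices_def face_of_singleton)
  have "vector [0, 0, 0] \<in> vertices prism"
    by (rule vert[of "{0, 1, 2}"])
      (auto simp: mem_prism prism_normal_def offset_def inner_vector_3 vec_eq_iff forall_3)
  moreover have "vector [1, 0, 0] \<in> vertices prism"
    by (rule vert[of "{1, 2, 4}"])
      (auto simp: mem_prism prism_normal_def offset_def inner_vector_3 vec_eq_iff forall_3)
  moreover have "vector [0, 1, 0] \<in> vertices prism"
    by (rule vert[of "{0, 2, 4}"])
      (auto simp: mem_prism prism_normal_def offset_def inner_vector_3 vec_eq_iff forall_3)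
  moreover have "vector [0, 0, 1] \<in> vertices prism"
    by (rule vert[of "{0, 1, 3}"])
      (auto simp: mem_prism prism_normal_def offset_def inner_vector_3 vec_eq_iff forall_3)
  moreover have "vector [1, 0, 1] \<in> vertices prism"
    by (rule vert[of "{1, 3, 4}"])
      (auto simp: mem_prism prism_normal_def offset_def inner_vector_3 vec_eq_iff forall_3)
  moreover have "vector [0, 1, 1] \<in> vertices prism"
    by (rule vert[of "{0, 3, 4}"])
      (auto simp: mem_prism prism_normal_def offset_def inner_vector_3 vec_eq_iff forall_3)
  ultimately have "{vector [0, 0, 0], vector [1, 0, 0], vector [0, 1, 0], vector [0, 0, 1],
      vector [1, 0, 1], vector [0, 1, 1]} \<subseteq> vertices prism" (is "?W \<subseteq> _") by simp
  moreover have "card ?W = 6" by (simp add: vec_eq_iff forall_3)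
  moreover have "finite (vertices prism)"
    using full_dim_prism by (simp add: full_dim_polytope_def finite_vertices)
  ultimately show ?thesis by (metis card_mono)
qed

section \<open>Slices with each coatom count from 0 to 5\<close>

text \<open>The slice may be rewritten with fewer inequalities, and on an affine set smaller than
  the plane, so that each remaining inequality has a point where it alone is tight.\<close>

lemma exists_slice_of_witnesses:
  fixes P :: "(real ^ 3) set"
  assumes "vector [p, q, r] \<noteq> (0 :: real ^ 3)" and A: "affine A" and K: "finite K" "card K = k" "2 \<le> k"
    and eq: "P \<inter> {x. p * x $ 1 + q * x $ 2 + r * x $ 3 = c} = hpoly A K a b"
    and w: "\<forall>i\<in>K. w i \<in> hpoly A K a b \<and> (\<forall>j\<in>K. a j \<bullet> w i = b j \<longleftrightarrow> j = i)"
  shows "\<exists>H\<in>affine_hyperplanes. card (coatoms (P \<inter> H)) = k"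
proof (rule bexI[OF _ plane_in_hyperplanes[OF assms(1)]])
  show "card (coatoms (P \<inter> {x. p * x $ 1 + q * x $ 2 + r * x $ 3 = c})) = k"
    unfolding eq K(2)[symmetric] using w K by (intro card_coatoms_hpoly A K) auto
qed

lemma affine_plane: "affine {x :: real ^ 3. p * x $ 1 + q * x $ 2 + r * x $ 3 = c}"
  using affine_hyperplane[of "vector [p, q, r] :: real ^ 3" c] by (simp add: inner_vector_3)

lemma affine_vertical_axis: "affine {x :: real ^ 3. x $ 1 = 0 \<and> x $ 2 = 0}"
  using affine_Int[OF affine_plane[of 1 0 0 0] affine_plane[of 0 1 0 0]]
  by (simp add: Collect_conj_eq)

lemma pyramid_slices:
  assumes "k \<le> 5"
  shows "\<exists>H\<in>affine_hyperplanes. card (coatoms (pyramid \<inter> H)) = k"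
proof -
  note eval = hpoly_def pyramid_normal_def offset_def inner_vector_3 mem_pyramid ball_lessThan_5
  consider "k = 0" | "k = 1" | "k = 2" | "k = 3" | "k = 4" | "k = 5" using assms by linarith
  then show ?thesis
  proof cases
    case 1
    have "pyramid \<inter> {x. 0 * x $ 1 + 0 * x $ 2 + 1 * x $ 3 = 2} = {}" by (auto simp: mem_pyramid)
    then show ?thesis using plane_in_hyperplanes[of 0 0 1 2]
      by (intro bexI) (auto simp: 1 coatoms_empty vec_eq_iff forall_3)
  next
    case 2
    have "pyramid \<inter> {x. 0 * x $ 1 + 0 * x $ 2 + 1 * x $ 3 = 1} = {vector [0, 0, 1]}"
      by (auto simp: mem_pyramid vec_eq_iff forall_3)
    then show ?thesis using plane_in_hyperplanes[of 0 0 1 1]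
      by (intro bexI) (auto simp: 2 coatoms_singleton vec_eq_iff forall_3)
  next
    case 3
    \<comment> \<open>The plane touches the pyramid only along a vertical edge. On the line of that
      edge the inequalities 3 and 4 agree, and one is kept.\<close>
    let ?A = "{x :: real ^ 3. x $ 1 = 0 \<and> x $ 2 = 0}"
    \<comment> \<open>Position \<open>i\<close> holds the witness for inequality \<open>i\<close>;
      zeros fill positions outside the index set.\<close>
    let ?w = "(!) [0, 0, vector [0, 0, 0], vector [0, 0, 1] :: real ^ 3]"
    have "\<exists>H\<in>affine_hyperplanes. card (coatoms (pyramid \<inter> H)) = 2"
    proof (rule exists_slice_of_witnesses[of 1 1 0 ?A "{2::nat, 3}"])
      show "affine ?A" by (rule affine_vertical_axis)
      show "pyramid \<inter> {x. 1 * x $ 1 + 1 * x $ 2 + 0 * x $ 3 = 0} = hpoly ?A {2, 3} pyramid_normal offset"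
        by (auto simp: eval)
      show "\<forall>i\<in>{2, 3}. ?w i \<in> hpoly ?A {2, 3} pyramid_normal offset \<and>
        (\<forall>j\<in>{2, 3}. pyramid_normal j \<bullet> ?w i = offset j \<longleftrightarrow> j = i)"
        by (simp add: eval)
    qed (auto simp: vec_eq_iff forall_3)
    then show ?thesis unfolding 3 .
  next
    case 4
    \<comment> \<open>A triangular facet: inequality 1 is tight throughout, and 4 follows from 0 and
      3.\<close>
    let ?A = "{x :: real ^ 3. 0 * x $ 1 + 1 * x $ 2 + 0 * x $ 3 = 0}"
    let ?w = "(!) [vector [0, 0, 1/2], 0, vector [1/2, 0, 0], vector [1/2, 0, 1/2] :: real ^ 3]"
    have "\<exists>H\<in>affine_hyperplanes. card (coatoms (pyramid \<inter> H)) = 3"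
    proof (rule exists_slice_of_witnesses[of 0 1 0 ?A "{0::nat, 2, 3}"])
      show "affine ?A" by (rule affine_plane)
      show "pyramid \<inter> ?A = hpoly ?A {0, 2, 3} pyramid_normal offset"
        by (auto simp: eval)
      show "\<forall>i\<in>{0, 2, 3}. ?w i \<in> hpoly ?A {0, 2, 3} pyramid_normal offset \<and>
        (\<forall>j\<in>{0, 2, 3}. pyramid_normal j \<bullet> ?w i = offset j \<longleftrightarrow> j = i)"
        by (simp add: eval)
    qed (auto simp: vec_eq_iff forall_3)
    then show ?thesis unfolding 4 .
  next
    case 5
    \<comment> \<open>Parallel to the base at half height, where inequality 2 is never
      tight.\<close>
    let ?A = "{x :: real ^ 3. 0 * x $ 1 + 0 * x $ 2 + 1 * x $ 3 = 1/2}"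
    let ?w = "(!) [vector [0, 1/4, 1/2], vector [1/4, 0, 1/2], 0,
      vector [1/2, 1/4, 1/2], vector [1/4, 1/2, 1/2] :: real ^ 3]"
    have "\<exists>H\<in>affine_hyperplanes. card (coatoms (pyramid \<inter> H)) = 4"
    proof (rule exists_slice_of_witnesses[of 0 0 1 ?A "{0::nat, 1, 3, 4}"])
      show "affine ?A" by (rule affine_plane)
      show "pyramid \<inter> ?A = hpoly ?A {0, 1, 3, 4} pyramid_normal offset"
        by (auto simp: eval)
      show "\<forall>i\<in>{0, 1, 3, 4}. ?w i \<in> hpoly ?A {0, 1, 3, 4} pyramid_normal offset \<and>
        (\<forall>j\<in>{0, 1, 3, 4}. pyramid_normal j \<bullet> ?w i = offset j \<longleftrightarrow> j = i)"
        by (simp add: eval)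
    qed (auto simp: vec_eq_iff forall_3)
    then show ?thesis unfolding 5 .
  next
    case 6
    \<comment> \<open>The plane separates the apex and the origin from the other three vertices, so
      every facet has vertices strictly on both sides.\<close>
    let ?A = "{x :: real ^ 3. 1 * x $ 1 + 1 * x $ 2 + 0 * x $ 3 = 1/2}"
    let ?w = "(!) [vector [0, 1/2, 1/4], vector [1/2, 0, 1/4], vector [1/4, 1/4, 0],
      vector [3/8, 1/8, 5/8], vector [1/8, 3/8, 5/8] :: real ^ 3]"
    have "\<exists>H\<in>affine_hyperplanes. card (coatoms (pyramid \<inter> H)) = 5"
    proof (rule exists_slice_of_witnesses[of 1 1 0 ?A "{..<5::nat}"])
      show "affine ?A" by (rule affine_plane)
      show "pyramid \<inter> ?A = hpoly ?A {..<5} pyramid_normal offset"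
        by (simp add: pyramid_def hpoly_Int_affine)
      show "\<forall>i\<in>{..<5}. ?w i \<in> hpoly ?A {..<5} pyramid_normal offset \<and>
        (\<forall>j\<in>{..<5}. pyramid_normal j \<bullet> ?w i = offset j \<longleftrightarrow> j = i)"
        by (simp add: eval)
    qed (auto simp: vec_eq_iff forall_3)
    then show ?thesis unfolding 6 .
  qed
qed

lemma prism_slices:
  assumes "k \<le> 5"
  shows "\<exists>H\<in>affine_hyperplanes. card (coatoms (prism \<inter> H)) = k"
proof -
  note eval = hpoly_def prism_normal_def offset_def inner_vector_3 mem_prism ball_lessThan_5
  consider "k = 0" | "k = 1" | "k = 2" | "k = 3" | "k = 4" | "k = 5" using assms by linarith
  then show ?thesis
  proof cases
    case 1
    have "prism \<inter> {x. 0 * x $ 1 + 0 * x $ 2 + 1 * x $ 3 = 2} = {}" by (auto simp: mem_prism)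
    then show ?thesis using plane_in_hyperplanes[of 0 0 1 2]
      by (intro bexI) (auto simp: 1 coatoms_empty vec_eq_iff forall_3)
  next
    case 2
    have "prism \<inter> {x. 1 * x $ 1 + 1 * x $ 2 + 1 * x $ 3 = 0} = {vector [0, 0, 0]}"
      by (auto simp: mem_prism vec_eq_iff forall_3)
    then show ?thesis using plane_in_hyperplanes[of 1 1 1 0]
      by (intro bexI) (auto simp: 2 coatoms_singleton vec_eq_iff forall_3)
  next
    case 3
    let ?A = "{x :: real ^ 3. x $ 1 = 0 \<and> x $ 2 = 0}"
    let ?w = "(!) [0, 0, vector [0, 0, 0], vector [0, 0, 1] :: real ^ 3]"
    have "\<exists>H\<in>affine_hyperplanes. card (coatoms (prism \<inter> H)) = 2"
    proof (rule exists_slice_of_witnesses[of 1 1 0 ?A "{2::nat, 3}"])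
      show "affine ?A" by (rule affine_vertical_axis)
      show "prism \<inter> {x. 1 * x $ 1 + 1 * x $ 2 + 0 * x $ 3 = 0} = hpoly ?A {2, 3} prism_normal offset"
        by (auto simp: eval)
      show "\<forall>i\<in>{2, 3}. ?w i \<in> hpoly ?A {2, 3} prism_normal offset \<and>
        (\<forall>j\<in>{2, 3}. prism_normal j \<bullet> ?w i = offset j \<longleftrightarrow> j = i)"
        by (simp add: eval)
    qed (auto simp: vec_eq_iff forall_3)
    then show ?thesis unfolding 3 .
  next
    case 4
    \<comment> \<open>The bottom triangle: inequality 2 is tight throughout and 3 is never
      tight.\<close>
    let ?A = "{x :: real ^ 3. 0 * x $ 1 + 0 * x $ 2 + 1 * x $ 3 = 0}"
    let ?w = "(!) [vector [0, 1/2, 0], vector [1/2, 0, 0], 0, 0, vector [1/2, 1/2, 0] :: real ^ 3]"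
    have "\<exists>H\<in>affine_hyperplanes. card (coatoms (prism \<inter> H)) = 3"
    proof (rule exists_slice_of_witnesses[of 0 0 1 ?A "{0::nat, 1, 4}"])
      show "affine ?A" by (rule affine_plane)
      show "prism \<inter> ?A = hpoly ?A {0, 1, 4} prism_normal offset"
        by (auto simp: eval)
      show "\<forall>i\<in>{0, 1, 4}. ?w i \<in> hpoly ?A {0, 1, 4} prism_normal offset \<and>
        (\<forall>j\<in>{0, 1, 4}. prism_normal j \<bullet> ?w i = offset j \<longleftrightarrow> j = i)"
        by (simp add: eval)
    qed (auto simp: vec_eq_iff forall_3)
    then show ?thesis unfolding 4 .
  next
    case 5
    let ?A = "{x :: real ^ 3. 0 * x $ 1 + 1 * x $ 2 + 0 * x $ 3 = 0}"
    let ?w = "(!) [vector [0, 0, 1/2], 0, vector [1/2, 0, 0],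
      vector [1/2, 0, 1], vector [1, 0, 1/2] :: real ^ 3]"
    have "\<exists>H\<in>affine_hyperplanes. card (coatoms (prism \<inter> H)) = 4"
    proof (rule exists_slice_of_witnesses[of 0 1 0 ?A "{0::nat, 2, 3, 4}"])
      show "affine ?A" by (rule affine_plane)
      show "prism \<inter> ?A = hpoly ?A {0, 2, 3, 4} prism_normal offset"
        by (auto simp: eval)
      show "\<forall>i\<in>{0, 2, 3, 4}. ?w i \<in> hpoly ?A {0, 2, 3, 4} prism_normal offset \<and>
        (\<forall>j\<in>{0, 2, 3, 4}. prism_normal j \<bullet> ?w i = offset j \<longleftrightarrow> j = i)"
        by (simp add: eval)
    qed (auto simp: vec_eq_iff forall_3)
    then show ?thesis unfolding 5 .
  next
    case 6
    \<comment> \<open>The plane separates (1, 0, 0), (0, 1, 0) and (1, 0, 1) from the other three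
      vertices, so every facet has vertices strictly on both sides.\<close>
    let ?A = "{x :: real ^ 3. 4 * x $ 1 + 2 * x $ 2 + (-2) * x $ 3 = 1}"
    let ?w = "(!) [vector [0, 3/4, 1/4], vector [1/2, 0, 1/2], vector [1/8, 1/4, 0],
      vector [5/8, 1/4, 1], vector [1/4, 3/4, 3/4] :: real ^ 3]"
    have "\<exists>H\<in>affine_hyperplanes. card (coatoms (prism \<inter> H)) = 5"
    proof (rule exists_slice_of_witnesses[of 4 2 "-2" ?A "{..<5::nat}"])
      show "affine ?A" by (rule affine_plane)
      show "prism \<inter> ?A = hpoly ?A {..<5} prism_normal offset"
        by (simp add: prism_def hpoly_Int_affine)
      show "\<forall>i\<in>{..<5}. ?w i \<in> hpoly ?A {..<5} prism_normal offset \<and>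
        (\<forall>j\<in>{..<5}. prism_normal j \<bullet> ?w i = offset j \<longleftrightarrow> j = i)"
        by (simp add: eval)
    qed (auto simp: vec_eq_iff forall_3)
    then show ?thesis unfolding 6 .
  qed
qed

lemma pyramid_setwise_slice_equiv_prism: "setwise_slice_equiv pyramid prism"
proof (rule setwise_slice_equiv_of_card_coatoms)
  fix H :: "(real ^ 3) set" assume "H \<in> affine_hyperplanes"
  then have "card (coatoms (hpoly UNIV {..<5} a b \<inter> H)) \<le> card {..<5::nat}"
    for a :: "nat \<Rightarrow> real ^ 3" and b
    unfolding hpoly_Int_affine by (intro card_coatoms_hpoly_le affine_affine_hyperplane) (auto simp: lessThan_empty_iff)
  then show "card (coatoms (pyramid \<inter> H)) \<le> 5" "card (coatoms (prism \<inter> H)) \<le> 5"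
    by (auto simp: pyramid_def prism_def)
qed (use full_dim_pyramid full_dim_prism pyramid_slices prism_slices in
    \<open>auto simp: full_dim_polytope_def\<close>)

theorem proposition5p10:
  assumes "CARD('n::finite) \<ge> 3"
  shows "(\<forall>P Q :: (real ^ 'n) set. full_dim_polytope P \<longrightarrow> full_dim_polytope Q \<longrightarrow>
            (pointwise_slice_equiv P Q \<longleftrightarrow> P = Q)) \<and>
         (\<exists>P Q :: (real ^ 'n) set. full_dim_polytope P \<and> full_dim_polytope Q \<and>
            P \<simeq>\<^sub>c Q \<and> \<not> setwise_slice_equiv P Q) \<and>
         (\<exists>P Q :: (real ^ 3) set. full_dim_polytope P \<and> full_dim_polytope Q \<and>
            setwise_slice_equiv P Q \<and> f_vector P \<noteq> f_vector Q \<and> \<not> P \<simeq>\<^sub>c Q)"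
proof (intro conjI allI impI)
  fix P Q :: "(real ^ 'n) set"
  assume "full_dim_polytope P" "full_dim_polytope Q"
  then show "pointwise_slice_equiv P Q \<longleftrightarrow> P = Q" by (rule pointwise_slice_equiv_iff_eq)
next
  have "\<not> CARD('n) \<le> Suc 0" using assms by simp
  then obtain j k :: 'n where "j \<noteq> k" by (auto simp: card_le_Suc0_iff_eq)
  then show "\<exists>P Q :: (real ^ 'n) set. full_dim_polytope P \<and> full_dim_polytope Q \<and>
      P \<simeq>\<^sub>c Q \<and> \<not> setwise_slice_equiv P Q"
    using full_dim_octa full_dim_skew_octa octa_comb_equiv_skew_octa
      octa_not_setwise_slice_equiv_skew_octa[OF _ assms] by meson
next
  have "card (vertices pyramid) \<noteq> card (vertices prism)"
    using card_vertices_pyramid card_vertices_prism by linarith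
  then have "f_vector pyramid \<noteq> f_vector prism" "\<not> pyramid \<simeq>\<^sub>c prism"
    using f_vector_0[of pyramid] f_vector_0[of prism] card_vertices_comb_equiv
      full_dim_pyramid full_dim_prism by (auto simp: full_dim_polytope_def)
  then show "\<exists>P Q :: (real ^ 3) set. full_dim_polytope P \<and> full_dim_polytope Q \<and>
      setwise_slice_equiv P Q \<and> f_vector P \<noteq> f_vector Q \<and> \<not> P \<simeq>\<^sub>c Q"
    using full_dim_pyramid full_dim_prism pyramid_setwise_slice_equiv_prism
    by meson
qed

end
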